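(* For every graph $G$ we have $p(G)\leq a(G)\leq \mathrm{sa}_\ell(G)\leq p(G)+1$, and each of these three inequalities is strict for some graph. Moreover, $\mathrm{sa}_\ell(G)=p(G)$ if and only if $G$ has an orientation whose maximum out-degree is $p(G)$ and in which out-degree $p(G)$ is attained only at vertices of degree $p(G)$.
   Context: All graphs are finite and simple. A star forest is a forest each of whose components is a star (equivalently, a forest containing no path with 3 edges). The arboricity $a(G)$ is the minimum number of forests whose union is $E(G)$. A pseudoforest is a graph with at most one cycle in each component; the pseudoarboricity $p(G)$ is the minimum number of pseudoforests whose union is $E(G)$. The local star arboricity $\mathrm{sa}_\ell(G)$ is the minimum, over all families of star forests $S_1,\dots,S_k$ that are subgraphs of $G$ and whose edge sets together cover $E(G)$ (with $k$ arbitrary), of the maximum over vertices $v$ of $G$ of the number of indices $i$ with $v\in V(S_i)$. Equivalently, $\mathrm{sa}_\ell(G)=c_\ell^{\mathcal S}(G)$, the minimum over edge-surjective homomorphisms $\varphi$ from a disjoint union of star forests to $G$ that are injective on each star forest, of $\max_v|\varphi^{-1}(v)|$. *)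

theory Defs
  imports Main
begin

record 'a graph =
  verts :: "'a set"
  edges :: "'a set set"

definition simple_graph :: "'a graph \<Rightarrow> bool" where
  "simple_graph G \<longleftrightarrow> finite (verts G) \<and> (\<forall>e\<in>edges G. e \<subseteq> verts G \<and> card e = 2)"

definition subgraph :: "'a graph \<Rightarrow> 'a graph \<Rightarrow> bool" where
  "subgraph H G \<longleftrightarrow> simple_graph H \<and> verts H \<subseteq> verts G \<and> edges H \<subseteq> edges G"

definition degree :: "'a graph \<Rightarrow> 'a \<Rightarrow> nat" where
  "degree G v = card {e \<in> edges G. v \<in> e}"

definition component_of :: "'a graph \<Rightarrow> 'a \<Rightarrow> 'a graph" where
  "component_of G v =
     (let K = {(x, y). {x, y} \<in> edges G}\<^sup>* `` {v}
      in \<lparr>verts = K, edges = {e \<in> edges G. e \<subseteq> K}\<rparr>)"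

definition components :: "'a graph \<Rightarrow> 'a graph set" where
  "components G = component_of G ` verts G"

text \<open>A cycle is represented by its edge set, so that cyclic sequences differing only in
  starting point or direction yield the same cycle.\<close>

definition cycle_edges :: "'a list \<Rightarrow> 'a set set" where
  "cycle_edges xs = {{xs ! i, xs ! (Suc i mod length xs)} | i. i < length xs}"

definition cycles :: "'a graph \<Rightarrow> 'a set set set" where
  "cycles G = {cycle_edges xs | xs. distinct xs \<and> 3 \<le> length xs \<and> cycle_edges xs \<subseteq> edges G}"

definition forest :: "'a graph \<Rightarrow> bool" where
  "forest G \<longleftrightarrow> cycles G = {}"

definition pseudoforest :: "'a graph \<Rightarrow> bool" where
  "pseudoforest G \<longleftrightarrow> (\<forall>C\<in>components G. \<forall>X\<in>cycles C. \<forall>Y\<in>cycles C. X = Y)"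

text \<open>A single vertex counts as a star.\<close>

definition star :: "'a graph \<Rightarrow> bool" where
  "star G \<longleftrightarrow> (\<exists>c\<in>verts G. edges G = {{c, v} | v. v \<in> verts G - {c}})"

definition star_forest :: "'a graph \<Rightarrow> bool" where
  "star_forest G \<longleftrightarrow> forest G \<and> (\<forall>C\<in>components G. star C)"

definition covers :: "nat \<Rightarrow> (nat \<Rightarrow> 'a graph) \<Rightarrow> 'a graph \<Rightarrow> bool" where
  "covers k S G \<longleftrightarrow> (\<forall>i<k. subgraph (S i) G) \<and> (\<Union>i<k. edges (S i)) = edges G"

definition arboricity :: "'a graph \<Rightarrow> nat" where
  "arboricity G = (LEAST k. \<exists>F. covers k F G \<and> (\<forall>i<k. forest (F i)))"

definition pseudoarboricity :: "'a graph \<Rightarrow> nat" where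
  "pseudoarboricity G = (LEAST k. \<exists>F. covers k F G \<and> (\<forall>i<k. pseudoforest (F i)))"

text \<open>A maximum over the vertices of the graph without vertices is taken to be 0, which is why 0
  is inserted in this definition and in that of the maximum out-degree below.\<close>

definition local_multiplicity :: "nat \<Rightarrow> (nat \<Rightarrow> 'a graph) \<Rightarrow> 'a graph \<Rightarrow> nat" where
  "local_multiplicity k S G = Max (insert 0 ((\<lambda>v. card {i. i < k \<and> v \<in> verts (S i)}) ` verts G))"

definition local_star_arboricity :: "'a graph \<Rightarrow> nat" where
  "local_star_arboricity G =
     (LEAST m. \<exists>k S. covers k S G \<and> (\<forall>i<k. star_forest (S i)) \<and> m = local_multiplicity k S G)"

text \<open>An orientation is given by its set of arcs, \<open>(u, v)\<close> being directed from \<open>u\<close> to \<open>v\<close>.\<close>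

definition orientation :: "'a graph \<Rightarrow> ('a \<times> 'a) set \<Rightarrow> bool" where
  "orientation G D \<longleftrightarrow>
     (\<forall>u v. (u, v) \<in> D \<longrightarrow> {u, v} \<in> edges G) \<and>
     (\<forall>u v. {u, v} \<in> edges G \<longrightarrow> ((u, v) \<in> D \<longleftrightarrow> (v, u) \<notin> D))"

definition out_degree :: "('a \<times> 'a) set \<Rightarrow> 'a \<Rightarrow> nat" where
  "out_degree D v = card {w. (v, w) \<in> D}"

definition max_out_degree :: "'a graph \<Rightarrow> ('a \<times> 'a) set \<Rightarrow> nat" where
  "max_out_degree G D = Max (insert 0 (out_degree D ` verts G))"

end

(* All three parameters are governed by orientations. Orienting each edge of a pseudoforest away
   from a vertex that is chosen injectively shows that p(G) <= k iff some orientation has all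
   out-degrees at most k. Orienting the edges of stars from leaf to centre, and conversely
   collecting the arcs into each head into a star, shows that sa(G) <= m iff some orientation
   satisfies outdeg(v) + [v is a head] <= m for all v. This gives sa(G) <= p(G) + 1 and the
   characterisation of equality. The same orientation bounds the number of edges inside a nonempty
   vertex set W by m(|W| - 1), and then G is a union of m forests by the Nash-Williams theorem,
   which is proved by an exchange argument valid in every finite matroid. The strict inequalities
   are witnessed by the triangle, the path with three edges and the empty graph. *)

theory Submission
  imports Defs
begin

section \<open>Matroid partition in the manner of Edmonds, stated with closures\<close>

section \<open>Partition into independent sets\<close>

text \<open>The matroid is given by a closure operator because edge closure is mere connectivity, a
  reflexive transitive closure; independence is derived from it and no rank function is set up.
  Accordingly, failure of a partition is reported not as a rank inequality but as a dense set: one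
  that, after losing an element, still contains \<open>k\<close> disjoint classes each spanning it.
  In a graph this becomes an excess of edges inside one component. A direct construction of the
  forests from the star orientation is not in sight: numbering the arcs out of each vertex yields
  classes with one outgoing arc per vertex, which are only pseudoforests. That heads send one arc
  fewer shows its effect only when arcs are counted over a whole vertex set, and Nash-Williams is
  what turns such counts into forests.\<close>

locale exchange_closure =
  fixes cl :: "'e set \<Rightarrow> 'e set"
  assumes extensive: "A \<subseteq> cl A"
    and mono: "A \<subseteq> B \<Longrightarrow> cl A \<subseteq> cl B"
    and idem: "cl (cl A) \<subseteq> cl A"
    and exchange: "\<lbrakk>e \<in> cl (insert y A); e \<notin> cl A\<rbrakk> \<Longrightarrow> y \<in> cl (insert e A)"
begin

definition indep :: "'e set \<Rightarrow> bool" where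
  "indep A \<longleftrightarrow> (\<forall>e\<in>A. e \<notin> cl (A - {e}))"

lemma cl_least: "A \<subseteq> cl B \<Longrightarrow> cl A \<subseteq> cl B"
  using mono[of A "cl B"] idem[of B] by blast

lemma indep_subset: "\<lbrakk>indep A; B \<subseteq> A\<rbrakk> \<Longrightarrow> indep B"
  unfolding indep_def using mono by (metis Diff_mono order_refl subsetD)

text \<open>If some \<open>f\<close> in \<open>A\<close> became spanned after adding
  \<open>e\<close>, exchange would put \<open>e\<close> into the closure of
  \<open>A\<close>.\<close>

lemma indep_insert:
  assumes "indep A" "e \<notin> cl A"
  shows "indep (insert e A)"
  unfolding indep_def
proof
  fix f assume f: "f \<in> insert e A"
  have "e \<notin> A"
    using assms(2) extensive by blast
  show "f \<notin> cl (insert e A - {f})"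
  proof (cases "f = e")
    case True
    then show ?thesis
      using assms(2) \<open>e \<notin> A\<close> by simp
  next
    case False
    then have "f \<in> A" and eq: "insert e A - {f} = insert e (A - {f})"
      using f by auto
    show ?thesis
    proof
      assume "f \<in> cl (insert e A - {f})"
      then have "e \<in> cl (insert f (A - {f}))"
        using exchange[of f e "A - {f}"] assms(1) \<open>f \<in> A\<close> eq unfolding indep_def by simp
      then show False
        using assms(2) \<open>f \<in> A\<close> by (simp add: insert_absorb)
    qed
  qed
qed

text \<open>For \<open>e\<close> outside \<open>A\<close> the set is the fundamental circuit of
  \<open>e\<close> without \<open>e\<close>, that is, the elements that \<open>e\<close> may
  replace. It contains every smallest \<open>M\<close> spanning \<open>e\<close>: by exchange each
  \<open>y\<close> in \<open>M\<close> is spanned by \<open>insert e (M - {y})\<close>, so if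
  \<open>A - {y}\<close> spanned \<open>e\<close> it would also span \<open>y\<close>.\<close>

lemma in_cl_replaceable:
  assumes "finite A" "indep A" "e \<in> cl A"
  shows "e \<in> cl {y \<in> A. e \<notin> cl (A - {y})}"
proof -
  have "\<exists>M. (M \<subseteq> A \<and> e \<in> cl M) \<and> (\<forall>N. N \<subseteq> A \<and> e \<in> cl N \<longrightarrow> card M \<le> card N)"
    by (rule ex_has_least_nat[of "\<lambda>M. M \<subseteq> A \<and> e \<in> cl M" A]) (use assms(3) in simp)
  then obtain M where M: "M \<subseteq> A" "e \<in> cl M"
    and least: "\<And>N. \<lbrakk>N \<subseteq> A; e \<in> cl N\<rbrakk> \<Longrightarrow> card M \<le> card N"
    by blast
  have "finite M"
    using M(1) assms(1) finite_subset by blast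
  have "e \<notin> cl (A - {y})" if y: "y \<in> M" for y
  proof
    assume e: "e \<in> cl (A - {y})"
    have "e \<notin> cl (M - {y})"
      using least[of "M - {y}"] M(1) y \<open>finite M\<close> card_Diff1_less[of M y] by fastforce
    then have "y \<in> cl (insert e (M - {y}))"
      using exchange[of e y "M - {y}"] M(2) y by (simp add: insert_absorb)
    moreover have "insert e (M - {y}) \<subseteq> cl (A - {y})"
      using e extensive[of "A - {y}"] M(1) by blast
    ultimately have "y \<in> cl (A - {y})"
      using cl_least by blast
    then show False
      using assms(2) y M(1) unfolding indep_def by blast
  qed
  then have "M \<subseteq> {y \<in> A. e \<notin> cl (A - {y})}"
    using M(1) by blast
  then show ?thesis
    using M(2) mono by blast
qed

text \<open>A state \<open>(c, e)\<close> is a colouring \<open>c\<close> of \<open>E - {e}\<close>. A swap colours \<open>e\<close> and uncolours an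
  element \<open>y\<close> of the circuit that this creates. Let \<open>S\<close> be the set of all elements which are
  uncoloured in some reachable state. If no reachable state can be completed, then the circuits
  lie in \<open>S\<close>, so a swap does not change the closure of the part of a colour class inside \<open>S\<close>;
  hence this closure contains all of \<open>S\<close>.\<close>

lemma insert_coloured_or_dense:
  fixes k :: nat
  assumes fin: "finite E" and e0: "e0 \<in> E"
    and c0: "\<forall>x\<in>E - {e0}. c0 x < k" "\<forall>i<k. indep {x \<in> E - {e0}. c0 x = i}"
  shows "(\<exists>c. (\<forall>x\<in>E. c x < k) \<and> (\<forall>i<k. indep {x \<in> E. c x = i})) \<or>
         (\<exists>S\<subseteq>E. e0 \<in> S \<and> (\<forall>i<k. S \<subseteq> cl {x \<in> S - {e0}. c0 x = i}))"
proof -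
  \<comment> \<open>A swap leaves a stale colour on the element that it uncolours; removing
    \<open>e\<close> here masks that value.\<close>
  define cls where "cls c e i = {x \<in> E - {e}. c x = i}" for c :: "'e \<Rightarrow> nat" and e i
  define swap where
    "swap = {((c, e), (c(e := i), y)) | c e i y.
       i < k \<and> y \<in> cls c e i \<and> e \<notin> cl (cls c e i - {y})}"
  define reach where "reach = swap\<^sup>* `` {(c0, e0)}"
  define S where "S = snd ` reach"
  have start: "(c0, e0) \<in> reach"
    unfolding reach_def by simp
  have step: "(c(e := i), y) \<in> reach"
    if "(c, e) \<in> reach" "i < k" "y \<in> cls c e i" "e \<notin> cl (cls c e i - {y})" for c e i y
  proof -
    have "((c, e), (c(e := i), y)) \<in> swap"
      unfolding swap_def using that by blast
    then show ?thesis
      using that(1) unfolding reach_def by (auto intro: rtrancl_into_rtrancl)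
  qed
  have induct: "P c e"
    if "(c, e) \<in> reach" "P c0 e0"
      and "\<And>c e i y. \<lbrakk>(c, e) \<in> reach; P c e; i < k; y \<in> cls c e i; e \<notin> cl (cls c e i - {y})\<rbrakk>
             \<Longrightarrow> P (c(e := i)) y"
    for P c e
  proof -
    have "((c0, e0), (c, e)) \<in> swap\<^sup>*"
      using that(1) unfolding reach_def by simp
    then have "case_prod P (c, e)"
    proof (induction rule: rtrancl_induct)
      case base
      then show ?case using that(2) by simp
    next
      case (step s t)
      then show ?case
        using that(3) unfolding swap_def reach_def by auto
    qed
    then show ?thesis by simp
  qed
  have cls_swap: "cls (c(e := i)) y j = (if j = i then insert e (cls c e i - {y}) else cls c e j)"
    if "e \<in> E" "y \<in> cls c e i" for c e i y j
    using that unfolding cls_def by auto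
  have inv: "e \<in> E \<and> (\<forall>x\<in>E - {e}. c x < k) \<and> (\<forall>i<k. indep (cls c e i))"
    if "(c, e) \<in> reach" for c e
  proof (rule induct[OF that])
    show "e0 \<in> E \<and> (\<forall>x\<in>E - {e0}. c0 x < k) \<and> (\<forall>i<k. indep (cls c0 e0 i))"
      using e0 c0 unfolding cls_def by simp
  next
    fix c e i y
    assume I: "e \<in> E \<and> (\<forall>x\<in>E - {e}. c x < k) \<and> (\<forall>i<k. indep (cls c e i))"
      and "i < k" and y: "y \<in> cls c e i" and e: "e \<notin> cl (cls c e i - {y})"
    have "indep (insert e (cls c e i - {y}))"
      using I \<open>i < k\<close> e by (intro indep_insert) (auto intro: indep_subset)
    then have "\<forall>j<k. indep (cls (c(e := i)) y j)"
      using I y cls_swap by auto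
    moreover have "y \<in> E"
      using y unfolding cls_def by simp
    ultimately show "y \<in> E \<and> (\<forall>x\<in>E - {y}. (c(e := i)) x < k) \<and>
        (\<forall>j<k. indep (cls (c(e := i)) y j))"
      using I \<open>i < k\<close> by auto
  qed
  show ?thesis
  proof (cases "\<exists>c e i. (c, e) \<in> reach \<and> i < k \<and> e \<notin> cl (cls c e i)")
    case True
    then obtain c e i where cei: "(c, e) \<in> reach" "i < k" "e \<notin> cl (cls c e i)"
      by blast
    note I = inv[OF cei(1)]
    have eq: "{x \<in> E. (c(e := i)) x = j} = (if j = i then insert e (cls c e i) else cls c e j)" for j
      using I unfolding cls_def by auto
    have "\<forall>j<k. indep {x \<in> E. (c(e := i)) x = j}"
      unfolding eq using I cei indep_insert by auto
    moreover have "\<forall>x\<in>E. (c(e := i)) x < k"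
      using I cei(2) by auto
    ultimately have "\<exists>c. (\<forall>x\<in>E. c x < k) \<and> (\<forall>j<k. indep {x \<in> E. c x = j})"
      by (intro exI[of _ "c(e := i)"]) simp
    then show ?thesis ..
  next
    case False
    have in_cl: "e \<in> cl (cls c e i \<inter> S)" if r: "(c, e) \<in> reach" and i: "i < k" for c e i
    proof -
      have "finite (cls c e i)"
        using fin unfolding cls_def by simp
      then have "e \<in> cl {y \<in> cls c e i. e \<notin> cl (cls c e i - {y})}"
        using in_cl_replaceable inv[OF r] False r i by blast
      moreover have "{y \<in> cls c e i. e \<notin> cl (cls c e i - {y})} \<subseteq> cls c e i \<inter> S"
        using step[OF r i] unfolding S_def by force
      ultimately show ?thesis
        using mono by blast
    qed
    \<comment> \<open>The inclusion leads from the current colouring back to the initial one, so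
      that a span found in any reachable state holds for \<open>c0\<close>.\<close>
    have same: "\<forall>i<k. cl (cls c e i \<inter> S) \<subseteq> cl (cls c0 e0 i \<inter> S)" if "(c, e) \<in> reach" for c e
    proof (rule induct[OF that])
      fix c e i y
      assume r: "(c, e) \<in> reach"
        and IH: "\<forall>i<k. cl (cls c e i \<inter> S) \<subseteq> cl (cls c0 e0 i \<inter> S)"
        and i: "i < k" and y: "y \<in> cls c e i" and "e \<notin> cl (cls c e i - {y})"
      have "insert e (cls c e i - {y}) \<inter> S \<subseteq> cl (cls c e i \<inter> S)"
        using in_cl[OF r i] extensive[of "cls c e i \<inter> S"] by blast
      then have "cl (insert e (cls c e i - {y}) \<inter> S) \<subseteq> cl (cls c e i \<inter> S)"
        by (rule cl_least)
      then show "\<forall>j<k. cl (cls (c(e := i)) y j \<inter> S) \<subseteq> cl (cls c0 e0 j \<inter> S)"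
        using IH i y inv[OF r] cls_swap by auto
    qed simp
    have "S \<subseteq> cl {x \<in> S - {e0}. c0 x = i}" if i: "i < k" for i
    proof
      fix x assume "x \<in> S"
      then obtain c where r: "(c, x) \<in> reach"
        unfolding S_def by auto
      have "x \<in> cl (cls c0 e0 i \<inter> S)"
        using in_cl[OF r i] same[OF r] i by blast
      moreover have "cls c0 e0 i \<inter> S \<subseteq> {x \<in> S - {e0}. c0 x = i}"
        unfolding cls_def by blast
      ultimately show "x \<in> cl {x \<in> S - {e0}. c0 x = i}"
        using mono by blast
    qed
    moreover have "S \<subseteq> E"
      using inv unfolding S_def by auto
    moreover have "e0 \<in> S"
      using start unfolding S_def by (metis image_eqI snd_conv)
    ultimately have "\<exists>S\<subseteq>E. e0 \<in> S \<and> (\<forall>i<k. S \<subseteq> cl {x \<in> S - {e0}. c0 x = i})"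
      by (intro exI[of _ S]) simp
    then show ?thesis ..
  qed
qed

text \<open>Elements are coloured one at a time, and a dense set met on the way stays dense in the
  larger set. The second alternative is the rank obstruction in disguise: \<open>k\<close> disjoint
  subsets of \<open>S - {e}\<close> each span \<open>S\<close>, so \<open>S\<close> has more than
  \<open>k\<close> times its rank many elements.\<close>

lemma coloured_or_dense:
  fixes k :: nat
  assumes "finite E"
  shows "(\<exists>c. (\<forall>x\<in>E. c x < k) \<and> (\<forall>i<k. indep {x \<in> E. c x = i})) \<or>
         (\<exists>S\<subseteq>E. \<exists>e\<in>S. \<exists>c. \<forall>i<k. S \<subseteq> cl {x \<in> S - {e}. c x = i})"
  using assms
proof (induction E rule: finite_induct)
  case empty
  then show ?case
    by (simp add: indep_def)
next
  case (insert e0 E)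
  show ?case
  proof (cases "\<exists>c. (\<forall>x\<in>E. c x < k) \<and> (\<forall>i<k. indep {x \<in> E. c x = i})")
    case True
    then obtain c where c: "\<forall>x\<in>E. c x < k" "\<forall>i<k. indep {x \<in> E. c x = i}"
      by blast
    have "insert e0 E - {e0} = E"
      using insert.hyps by simp
    then have "(\<exists>c. (\<forall>x\<in>insert e0 E. c x < k) \<and> (\<forall>i<k. indep {x \<in> insert e0 E. c x = i})) \<or>
        (\<exists>S\<subseteq>insert e0 E. e0 \<in> S \<and> (\<forall>i<k. S \<subseteq> cl {x \<in> S - {e0}. c x = i}))"
      using insert.hyps(1) c by (intro insert_coloured_or_dense) simp_all
    then show ?thesis
    proof
      assume "\<exists>S\<subseteq>insert e0 E. e0 \<in> S \<and> (\<forall>i<k. S \<subseteq> cl {x \<in> S - {e0}. c x = i})"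
      then obtain S where "S \<subseteq> insert e0 E" "e0 \<in> S" "\<forall>i<k. S \<subseteq> cl {x \<in> S - {e0}. c x = i}"
        by (elim exE conjE)
      then show ?thesis
        by (intro disjI2 exI[of _ S] conjI bexI[of _ e0] exI[of _ c])
    qed (rule disjI1)
  next
    case False
    have "\<exists>S\<subseteq>E. \<exists>e\<in>S. \<exists>c. \<forall>i<k. S \<subseteq> cl {x \<in> S - {e}. c x = i}"
      using insert.IH by (rule disjE) (erule notE[OF False])
    then obtain S where "S \<subseteq> E" "\<exists>e\<in>S. \<exists>c. \<forall>i<k. S \<subseteq> cl {x \<in> S - {e}. c x = i}"
      by (elim exE conjE)
    then show ?thesis
      by (intro disjI2 exI[of _ S]) (simp add: subset_insertI2)
  qed
qed

lemma ex_maximal_indep: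
  assumes "finite F"
  shows "\<exists>T\<subseteq>F. indep T \<and> F \<subseteq> cl T"
proof -
  have "\<exists>T. (T \<subseteq> F \<and> indep T) \<and> (\<forall>U. U \<subseteq> F \<and> indep U \<longrightarrow> card U \<le> card T)"
    by (rule ex_has_greatest_nat[of "\<lambda>T. T \<subseteq> F \<and> indep T" "{}" card "Suc (card F)"])
      (use assms in \<open>auto simp: indep_def card_mono less_Suc_eq_le\<close>)
  then obtain T where T: "T \<subseteq> F" "indep T" "\<And>U. \<lbrakk>U \<subseteq> F; indep U\<rbrakk> \<Longrightarrow> card U \<le> card T"
    by blast
  have "x \<in> cl T" if "x \<in> F" for x
  proof (rule ccontr)
    assume x: "x \<notin> cl T"
    then have "x \<notin> T"
      using extensive by blast
    moreover have "finite T"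
      using T(1) assms finite_subset by blast
    ultimately show False
      using T(3)[of "insert x T"] T(1) indep_insert[OF T(2) x] that by simp
  qed
  then show ?thesis
    using T(1,2) by blast
qed

end

section \<open>Graphic closure by connectivity, and its relation to vertex counts and cycles\<close>

section \<open>The cycle matroid of a graph\<close>

definition conn :: "'a set set \<Rightarrow> ('a \<times> 'a) set" where
  "conn F = {(x, y). {x, y} \<in> F}\<^sup>*"

text \<open>Sets that are not of the form \<open>{x, y}\<close>, and singletons, lie in every
  closure. They act as loops, which gives a closure operator on the whole type without a
  carrier.\<close>

definition edge_cl :: "'a set set \<Rightarrow> 'a set set" where
  "edge_cl F = {e. \<forall>x y. e = {x, y} \<longrightarrow> (x, y) \<in> conn F}"

lemma conn_refl [simp]: "(x, x) \<in> conn F"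
  unfolding conn_def by simp

lemma conn_sym: "(x, y) \<in> conn F \<Longrightarrow> (y, x) \<in> conn F"
proof -
  have "sym {(x, y). {x, y} \<in> F}"
    by (auto simp: sym_def insert_commute)
  then show "(x, y) \<in> conn F \<Longrightarrow> (y, x) \<in> conn F"
    unfolding conn_def using sym_rtrancl symD by metis
qed

lemma conn_trans: "\<lbrakk>(x, y) \<in> conn F; (y, z) \<in> conn F\<rbrakk> \<Longrightarrow> (x, z) \<in> conn F"
  unfolding conn_def by (rule rtrancl_trans)

lemma conn_edge: "{x, y} \<in> F \<Longrightarrow> (x, y) \<in> conn F"
  unfolding conn_def by auto

lemma conn_mono: "F \<subseteq> F' \<Longrightarrow> conn F \<subseteq> conn F'"
  unfolding conn_def by (intro rtrancl_mono) auto

lemma conn_invariant: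
  assumes "(x, y) \<in> conn F" "P x" "\<And>u v. \<lbrakk>{u, v} \<in> F; P u\<rbrakk> \<Longrightarrow> P v"
  shows "P y"
  using assms(1) unfolding conn_def
  by (induction rule: rtrancl_induct) (use assms(2,3) in auto)

lemma conn_least:
  assumes "F \<subseteq> edge_cl F'" "(x, y) \<in> conn F"
  shows "(x, y) \<in> conn F'"
  using assms(2)
proof (rule conn_invariant[of x y F "\<lambda>z. (x, z) \<in> conn F'"])
  fix u v assume "{u, v} \<in> F" "(x, u) \<in> conn F'"
  then show "(x, v) \<in> conn F'"
    using assms(1) unfolding edge_cl_def by (blast intro: conn_trans)
qed simp

lemma edge_clI: "(x, y) \<in> conn F \<Longrightarrow> {x, y} \<in> edge_cl F"
  unfolding edge_cl_def by (auto simp: doubleton_eq_iff intro: conn_sym)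

lemma edge_clD: "{x, y} \<in> edge_cl F \<Longrightarrow> (x, y) \<in> conn F"
  unfolding edge_cl_def by blast

text \<open>A walk that needs \<open>e\<close> can be shortened to cross it exactly once;
  \<open>a\<close> is where it enters \<open>e\<close> and \<open>b\<close> where it leaves.\<close>

lemma conn_insertD:
  assumes "(u, v) \<in> conn (insert e F)" "(u, v) \<notin> conn F"
  obtains a b where "e = {a, b}" "(u, a) \<in> conn F" "(b, v) \<in> conn F"
proof -
  have "(u, v) \<in> conn F \<or> (\<exists>a b. e = {a, b} \<and> (u, a) \<in> conn F \<and> (b, v) \<in> conn F)"
    using assms(1)
  proof (rule conn_invariant)
    fix w z assume "{w, z} \<in> insert e F"
      and IH: "(u, w) \<in> conn F \<or> (\<exists>a b. e = {a, b} \<and> (u, a) \<in> conn F \<and> (b, w) \<in> conn F)"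
    then consider "{w, z} = e" | "{w, z} \<in> F"
      by blast
    then show "(u, z) \<in> conn F \<or> (\<exists>a b. e = {a, b} \<and> (u, a) \<in> conn F \<and> (b, z) \<in> conn F)"
    proof cases
      case 1
      show ?thesis
        using IH
      proof
        assume "(u, w) \<in> conn F"
        then show ?thesis using 1 conn_refl by metis
      next
        assume "\<exists>a b. e = {a, b} \<and> (u, a) \<in> conn F \<and> (b, w) \<in> conn F"
        then obtain a b where ab: "e = {a, b}" "(u, a) \<in> conn F" "(b, w) \<in> conn F"
          by blast
        then consider "w = a" "z = b" | "w = b" "z = a"
          using 1 by (auto simp: doubleton_eq_iff)
        then show ?thesis
        proof cases
          case 1
          have "(z, z) \<in> conn F" by simp
          then show ?thesis using ab 1 by blast
        next
          \<comment> \<open>Crossing \<open>e\<close> backwards returns to \<open>a\<close>, which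
            \<open>F\<close> alone connects to \<open>u\<close>.\<close>
          case 2
          then show ?thesis using ab by simp
        qed
      qed
    next
      case 2
      then show ?thesis
        using IH conn_edge conn_trans by metis
    qed
  qed simp
  then show thesis
    using assms(2) that by blast
qed

text \<open>For exchange, a connection \<open>u - a - b - v\<close> that needs
  \<open>y = {a, b}\<close> is turned round: with \<open>e = {u, v}\<close> present,
  \<open>a\<close> reaches \<open>b\<close> through \<open>u\<close> and \<open>v\<close>.\<close>

global_interpretation edges: exchange_closure edge_cl
proof
  show "A \<subseteq> edge_cl A" for A :: "'a set set"
    unfolding edge_cl_def by (auto intro: conn_edge)
  show "edge_cl A \<subseteq> edge_cl B" if "A \<subseteq> B" for A B :: "'a set set"
    using conn_mono[OF that] unfolding edge_cl_def by blast
  show "edge_cl (edge_cl A) \<subseteq> edge_cl A" for A :: "'a set set"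
  proof
    fix e assume e: "e \<in> edge_cl (edge_cl A)"
    have "(x, y) \<in> conn A" if "e = {x, y}" for x y
      using conn_least[OF order_refl] edge_clD e that by metis
    then show "e \<in> edge_cl A"
      unfolding edge_cl_def by simp
  qed
  show "y \<in> edge_cl (insert e A)" if e: "e \<in> edge_cl (insert y A)" "e \<notin> edge_cl A"
    for e y :: "'a set" and A
  proof -
    obtain u v where uv: "e = {u, v}" "(u, v) \<notin> conn A"
      using e(2) unfolding edge_cl_def by auto
    have "(u, v) \<in> conn (insert y A)"
      using e(1) unfolding uv(1) by (rule edge_clD)
    then obtain a b where ab: "y = {a, b}" "(u, a) \<in> conn A" "(b, v) \<in> conn A"
      using uv(2) by (rule conn_insertD)
    have "(u, a) \<in> conn (insert e A)" "(b, v) \<in> conn (insert e A)"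
      using ab conn_mono[of A "insert e A"] by blast+
    moreover have "(u, v) \<in> conn (insert e A)"
      using uv(1) by (intro conn_edge) simp
    ultimately have "(a, b) \<in> conn (insert e A)"
      by (meson conn_sym conn_trans)
    then show ?thesis
      unfolding ab(1) by (rule edge_clI)
  qed
qed

text \<open>Arbitrary sets \<open>R\<close> of representatives are allowed so that the induction
  goes through: deleting an edge may split a component, which costs one further
  representative.\<close>

lemma card_le_edges_plus_reps:
  assumes "finite F" "finite R" "\<forall>v\<in>V. \<exists>r\<in>R. (v, r) \<in> conn F"
  shows "finite V \<and> card V \<le> card F + card R"
  using assms
proof (induction F arbitrary: R rule: finite_induct)
  case empty
  have "V \<subseteq> R"
  proof
    fix v assume "v \<in> V"
    then obtain r where r: "r \<in> R" "(v, r) \<in> conn {}"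
      using empty.prems by blast
    have "r = v"
      using r(2) by (rule conn_invariant) auto
    then show "v \<in> R"
      using r by simp
  qed
  then show ?case
    using empty.prems(1) by (auto intro: card_mono finite_subset)
next
  case (insert e F)
  show ?case
  proof (cases "\<forall>v\<in>V. \<exists>r\<in>R. (v, r) \<in> conn F")
    case True
    then show ?thesis
      using insert.IH[OF insert.prems(1)] insert.hyps by simp
  next
    case False
    then obtain v0 where v0: "v0 \<in> V" "\<forall>r\<in>R. (v0, r) \<notin> conn F"
      by blast
    then obtain r0 where r0: "r0 \<in> R" "(v0, r0) \<in> conn (insert e F)"
      using insert.prems(2) by blast
    moreover have "(v0, r0) \<notin> conn F"
      using v0(2) r0(1) by blast
    ultimately obtain a b where ab: "e = {a, b}" "(v0, a) \<in> conn F" "(b, r0) \<in> conn F"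
      using conn_insertD by metis
    \<comment> \<open>The new representative \<open>a\<close> is the end of \<open>e\<close> on the
      side of \<open>v0\<close>. A vertex not served by it would have to enter \<open>e\<close> at
      \<open>b\<close>, and \<open>b\<close> is still connected to \<open>r0\<close>.\<close>
    have "\<exists>r\<in>insert a R. (v, r) \<in> conn F" if v: "v \<in> V" for v
    proof (rule ccontr)
      assume none: "\<not> ?thesis"
      obtain r where r: "r \<in> R" "(v, r) \<in> conn (insert e F)"
        using insert.prems(2) v by blast
      moreover have "(v, r) \<notin> conn F"
        using none r(1) by blast
      ultimately obtain c d where cd: "e = {c, d}" "(v, c) \<in> conn F" "(d, r) \<in> conn F"
        using conn_insertD by metis
      then have "c = b"
        using ab(1) none by (auto simp: doubleton_eq_iff)
      then have "(v, r0) \<in> conn F"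
        using cd(2) ab(3) conn_trans by metis
      then show False
        using none r0(1) by blast
    qed
    then have "finite V \<and> card V \<le> card F + card (insert a R)"
      using insert.IH[of "insert a R"] insert.prems(1) by blast
    moreover have "card (insert a R) \<le> Suc (card R)"
      by (simp add: card_insert_le_m1 insert.prems(1) card_insert_if)
    ultimately show ?thesis
      using insert.hyps by auto
  qed
qed

text \<open>A walk from \<open>x\<close> never leaves the component of \<open>x\<close>. This
  localises spanning statements, so that edges can be counted inside a single component.\<close>

lemma conn_in_component:
  assumes "(x, v) \<in> conn B" "B \<subseteq> S"
  shows "(x, v) \<in> conn {e \<in> B. e \<subseteq> conn S `` {x}}"
proof -
  have "(x, v) \<in> conn S \<and> (x, v) \<in> conn {e \<in> B. e \<subseteq> conn S `` {x}}"
    using assms(1)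
  proof (rule conn_invariant)
    fix a b assume ab: "{a, b} \<in> B"
      "(x, a) \<in> conn S \<and> (x, a) \<in> conn {e \<in> B. e \<subseteq> conn S `` {x}}"
    have "(a, b) \<in> conn S"
      using ab(1) assms(2) by (intro conn_edge) blast
    then have xb: "(x, b) \<in> conn S"
      using ab(2) conn_trans by metis
    then have "(a, b) \<in> conn {e \<in> B. e \<subseteq> conn S `` {x}}"
      using ab by (intro conn_edge) simp
    then show "(x, b) \<in> conn S \<and> (x, b) \<in> conn {e \<in> B. e \<subseteq> conn S `` {x}}"
      using xb conn_trans[of x a _ b] ab(2) by blast
  qed simp
  then show ?thesis ..
qed

lemma finite_connected_card_le:
  assumes "finite F" "\<And>v. v \<in> V \<Longrightarrow> (v, r) \<in> conn F"
  shows "finite V" "card V \<le> card F + 1"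
  using card_le_edges_plus_reps[of F "{r}" V] assms by auto

text \<open>The rest of the cycle joins the ends of \<open>e\<close>: starting after index
  \<open>i\<close>, \<open>length xs - 1\<close> steps lead back to \<open>i\<close>. Having three
  vertices prevents a step from being \<open>e\<close> traversed backwards.\<close>

lemma cycle_edge_in_cl:
  assumes "distinct xs" "3 \<le> length xs" "e \<in> cycle_edges xs"
  shows "e \<in> edge_cl (cycle_edges xs - {e})"
proof -
  let ?n = "length xs"
  obtain i where i: "i < ?n" "e = {xs ! i, xs ! (Suc i mod ?n)}"
    using assms(3) unfolding cycle_edges_def by blast
  let ?v = "\<lambda>j. xs ! ((Suc i + j) mod ?n)"
  have idx: "xs ! (a mod ?n) = xs ! b \<longleftrightarrow> a mod ?n = b" if "b < ?n" for a b
    using that by (intro nth_eq_iff_index_eq[OF assms(1)] mod_less_divisor) linarith+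
  have red: "a mod ?n = (if a < ?n then a else a - ?n)" if "a < 2 * ?n" for a
    using that by (simp add: le_mod_geq)
  have ne: "{?v j, ?v (Suc j)} \<noteq> e" if j: "Suc j < ?n" for j
  proof
    assume "{?v j, ?v (Suc j)} = e"
    then consider "?v j = xs ! i" | "?v (Suc j) = xs ! i" "?v j = xs ! (Suc i mod ?n)"
      unfolding i(2) by (auto simp: doubleton_eq_iff)
    then show False
    proof cases
      case 1
      then have "(Suc i + j) mod ?n = i"
        using idx i(1) by blast
      then show False
        using j i(1) red[of "Suc i + j"] by (auto split: if_splits)
    next
      case 2
      then have "(Suc i + Suc j) mod ?n = i" "(Suc i + j) mod ?n = Suc i mod ?n"
        using idx i(1) mod_less_divisor[of ?n "Suc i"] assms(2) by fastforce+
      then show False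
        using j i(1) assms(2) red[of "Suc i + Suc j"] red[of "Suc i + j"] red[of "Suc i"]
        by (auto split: if_splits)
    qed
  qed
  have "(?v 0, ?v j) \<in> conn (cycle_edges xs - {e})" if "j < ?n" for j
    using that
  proof (induction j)
    case 0
    show ?case by simp
  next
    case (Suc j)
    have "(Suc i + j) mod ?n < ?n"
      using i(1) by (intro mod_less_divisor) linarith
    then have "{?v j, ?v (Suc j)} \<in> cycle_edges xs"
      unfolding cycle_edges_def by (auto intro!: exI[of _ "(Suc i + j) mod ?n"] simp: mod_Suc_eq)
    then have "(?v j, ?v (Suc j)) \<in> conn (cycle_edges xs - {e})"
      using ne[OF Suc.prems] by (intro conn_edge) simp
    then show ?case
      using Suc by (auto intro: conn_trans)
  qed
  moreover have "Suc i + (?n - 1) = i + ?n"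
    using i(1) by linarith
  ultimately have "(xs ! (Suc i mod ?n), xs ! ((i + ?n) mod ?n)) \<in> conn (cycle_edges xs - {e})"
    using i(1) by (metis add.right_neutral diff_less gr_implies_not0 gr_zeroI zero_less_one)
  then have "(xs ! (Suc i mod ?n), xs ! i) \<in> conn (cycle_edges xs - {e})"
    using i(1) by simp
  then show ?thesis
    unfolding i(2) by (subst insert_commute) (rule edge_clI)
qed

text \<open>When the next vertex already lies on the path, the path is cut back to it.\<close>

lemma conn_simple_path:
  assumes "(x, y) \<in> conn T"
  shows "\<exists>xs. xs \<noteq> [] \<and> distinct xs \<and> hd xs = x \<and> last xs = y \<and>
    successively (\<lambda>u v. {u, v} \<in> T) xs"
  using assms
proof (rule conn_invariant)
  show "\<exists>xs. xs \<noteq> [] \<and> distinct xs \<and> hd xs = x \<and> last xs = x \<and>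
      successively (\<lambda>u v. {u, v} \<in> T) xs"
    by (rule exI[of _ "[x]"]) simp
next
  fix u v assume uv: "{u, v} \<in> T"
    and "\<exists>xs. xs \<noteq> [] \<and> distinct xs \<and> hd xs = x \<and> last xs = u \<and>
      successively (\<lambda>u v. {u, v} \<in> T) xs"
  then obtain xs where xs: "xs \<noteq> []" "distinct xs" "hd xs = x" "last xs = u"
    "successively (\<lambda>u v. {u, v} \<in> T) xs"
    by blast
  show "\<exists>xs. xs \<noteq> [] \<and> distinct xs \<and> hd xs = x \<and> last xs = v \<and>
      successively (\<lambda>u v. {u, v} \<in> T) xs"
  proof (cases "v \<in> set xs")
    case True
    then obtain ys zs where "xs = ys @ v # zs"
      by (meson split_list)
    then show ?thesis
      using xs by (intro exI[of _ "ys @ [v]"])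
        (auto simp: successively_append_iff hd_append split: if_splits)
  next
    case False
    then show ?thesis
      using xs uv by (intro exI[of _ "xs @ [v]"]) (auto simp: successively_append_iff)
  qed
qed

text \<open>The edge closes a simple path from \<open>x\<close> to \<open>y\<close>. One vertex on
  the path would mean \<open>x = y\<close>, two would put \<open>{x, y}\<close> into
  \<open>T\<close>.\<close>

lemma ex_cycle_through:
  assumes "(x, y) \<in> conn T" "x \<noteq> y" "{x, y} \<notin> T"
  shows "\<exists>xs. distinct xs \<and> 3 \<le> length xs \<and> cycle_edges xs \<subseteq> insert {x, y} T \<and>
    {x, y} \<in> cycle_edges xs"
proof -
  obtain xs where xs: "xs \<noteq> []" "distinct xs" "hd xs = x" "last xs = y"
    "successively (\<lambda>u v. {u, v} \<in> T) xs"
    using conn_simple_path[OF assms(1)] by blast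
  let ?n = "length xs"
  have ends: "xs ! 0 = x" "xs ! (?n - 1) = y"
    using xs(1,3,4) by (simp_all add: hd_conv_nth last_conv_nth)
  have "?n \<noteq> 0"
    using xs(1) by simp
  moreover have "?n \<noteq> 1"
    using ends assms(2) by auto
  moreover have "?n \<noteq> 2"
    using ends assms(3) xs(5) by (auto simp: successively_conv_nth)
  ultimately have n: "3 \<le> ?n"
    by linarith
  have "{xs ! i, xs ! (Suc i mod ?n)} \<in> insert {x, y} T" if "i < ?n" for i
  proof (cases "Suc i < ?n")
    case True
    then show ?thesis
      using xs(5) by (simp add: successively_conv_nth)
  next
    case False
    then have "i = ?n - 1" "Suc i = ?n"
      using that by auto
    then show ?thesis
      using ends by (simp add: insert_commute)
  qed
  moreover have "{x, y} = {xs ! (?n - 1), xs ! (Suc (?n - 1) mod ?n)}"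
  proof -
    have "Suc (?n - 1) = ?n"
      using n by linarith
    then have "Suc (?n - 1) mod ?n = 0"
      by (metis mod_self)
    then show ?thesis
      using ends by (metis insert_commute)
  qed
  ultimately show ?thesis
    using xs(2) n unfolding cycle_edges_def by (intro exI[of _ xs]) auto
qed

lemma cycle_connected:
  assumes "cycle_edges xs \<subseteq> F" "e \<in> cycle_edges xs" "f \<in> cycle_edges xs" "u \<in> e" "v \<in> f"
  shows "(u, v) \<in> conn F"
proof -
  have *: "(xs ! 0, xs ! i) \<in> conn F" if "i < length xs" for i
    using that
  proof (induction i)
    case (Suc i)
    then have "{xs ! i, xs ! (Suc i mod length xs)} \<in> F"
      using assms(1) Suc_lessD unfolding cycle_edges_def by blast
    then show ?case
      using Suc conn_edge conn_trans by (metis Suc_lessD mod_less)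
  qed simp
  have "(xs ! 0, w) \<in> conn F" if g: "g \<in> cycle_edges xs" and w: "w \<in> g" for g w
  proof -
    obtain i where i: "i < length xs" "g = {xs ! i, xs ! (Suc i mod length xs)}"
      using g unfolding cycle_edges_def by blast
    have "Suc i mod length xs < length xs"
      using i(1) by (intro mod_less_divisor) linarith
    then show ?thesis
      using w *[of i] *[of "Suc i mod length xs"] i by auto
  qed
  then show ?thesis
    using assms(2-5) conn_sym conn_trans by metis
qed

section \<open>Pseudoforests as the graphs whose edges admit distinct tails\<close>

section \<open>Edge tails\<close>

text \<open>\<open>R\<close> holds at most one root per tree, and each edge is directed towards the
  root. A new edge joins two trees of \<open>T\<close>, at least one of them without a root; the end
  \<open>z\<close> in that tree becomes the tail of the new edge and the root of that tree.\<close>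

lemma indep_ex_tails:
  assumes "finite T" "edges.indep T" "\<And>r s. \<lbrakk>r \<in> R; s \<in> R; (r, s) \<in> conn T\<rbrakk> \<Longrightarrow> r = s"
  shows "\<exists>t. inj_on t T \<and> (\<forall>e\<in>T. t e \<in> e \<and> t e \<notin> R)"
  using assms
proof (induction T arbitrary: R rule: finite_induct)
  case empty
  then show ?case by simp
next
  case (insert e T)
  have sub: "conn T \<subseteq> conn (insert e T)"
    by (intro conn_mono) blast
  have "e \<notin> edge_cl T"
    using insert.prems(1) insert.hyps(2) unfolding edges.indep_def by auto
  then obtain x y where e: "e = {x, y}" and xy: "(x, y) \<notin> conn T"
    unfolding edge_cl_def by auto
  have "(x, y) \<in> conn (insert e T)"
    using e by (intro conn_edge) simp
  obtain z where z: "z \<in> e" "\<And>r. r \<in> R \<Longrightarrow> (r, z) \<notin> conn T"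
  proof (cases "\<exists>r\<in>R. (r, y) \<in> conn T")
    case True
    then obtain r' where r': "r' \<in> R" "(r', y) \<in> conn T"
      by blast
    have "(r, x) \<notin> conn T" if r: "r \<in> R" for r
    proof
      assume rx: "(r, x) \<in> conn T"
      then have "(r, r') \<in> conn (insert e T)"
        using r'(2) sub \<open>(x, y) \<in> conn (insert e T)\<close> by (meson conn_sym conn_trans subsetD)
      then have "r = r'"
        using insert.prems(2) r r'(1) by blast
      then show False
        using rx r'(2) xy by (meson conn_sym conn_trans)
    qed
    then show thesis
      using that[of x] e by blast
  next
    case False
    then show thesis
      using that[of y] e by blast
  qed
  have "\<exists>t. inj_on t T \<and> (\<forall>f\<in>T. t f \<in> f \<and> t f \<notin> insert z R)"
  proof (rule insert.IH)
    show "edges.indep T"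
      using insert.prems(1) edges.indep_subset by blast
    show "r = s" if "r \<in> insert z R" "s \<in> insert z R" "(r, s) \<in> conn T" for r s
      using that z(2) insert.prems(2) sub by (auto dest: conn_sym)
  qed
  then obtain t where t: "inj_on t T" "\<forall>f\<in>T. t f \<in> f \<and> t f \<notin> insert z R"
    by blast
  have "z \<notin> R"
    using z(2) conn_refl by metis
  then have "inj_on (t(e := z)) (insert e T) \<and> (\<forall>f\<in>insert e T. (t(e := z)) f \<in> f \<and> (t(e := z)) f \<notin> R)"
    using t z(1) insert.hyps(2) by (auto simp: inj_on_def)
  then show ?case
    by (intro exI[of _ "t(e := z)"])
qed

lemma simple_graph_finite_edges: "simple_graph G \<Longrightarrow> finite (edges G)"
  unfolding simple_graph_def by (auto intro: finite_subset[of "edges G" "Pow (verts G)"])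

lemma simple_graph_edge:
  assumes "simple_graph G" "e \<in> edges G"
  obtains x y where "e = {x, y}" "x \<noteq> y" "x \<in> verts G" "y \<in> verts G"
proof -
  have "e \<subseteq> verts G" "card e = 2"
    using assms unfolding simple_graph_def by blast+
  then show thesis
    using that by (auto simp: card_2_iff)
qed

lemma component_of_simps [simp]:
  "verts (component_of G v) = conn (edges G) `` {v}"
  "edges (component_of G v) = {e \<in> edges G. e \<subseteq> conn (edges G) `` {v}}"
  by (simp_all add: component_of_def conn_def Let_def)

text \<open>Take a spanning forest \<open>T\<close>. An edge outside \<open>T\<close> gets an
  arbitrary end \<open>r e\<close> as its tail; this end serves as the root of its tree, and the
  edges of \<open>T\<close> are directed to the roots. It remains to see that no tree receives two
  roots.\<close>

lemma pseudoforest_ex_tails: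
  assumes G: "simple_graph G" and "pseudoforest G"
  shows "\<exists>t. inj_on t (edges G) \<and> (\<forall>e\<in>edges G. t e \<in> e)"
proof -
  let ?F = "edges G"
  note fin = simple_graph_finite_edges[OF G]
  obtain T where T: "T \<subseteq> ?F" "edges.indep T" "?F \<subseteq> edge_cl T"
    using edges.ex_maximal_indep[OF fin] by blast
  have "\<exists>v. v \<in> e" if "e \<in> ?F" for e
    using simple_graph_edge[OF G that] by blast
  then obtain r where r: "\<And>e. e \<in> ?F \<Longrightarrow> r e \<in> e"
    by metis
  have ex_cycle: "\<exists>X. X \<in> cycles G \<and> e \<in> X \<and> X \<subseteq> insert e T" if eF: "e \<in> ?F - T" for e
  proof -
    obtain x y where e: "e = {x, y}" "x \<noteq> y"
      using simple_graph_edge[OF G DiffD1[OF eF]] by blast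
    have "e \<in> edge_cl T"
      using T(3) eF by blast
    then have "(x, y) \<in> conn T"
      unfolding e(1) by (rule edge_clD)
    then obtain xs where xs: "distinct xs" "3 \<le> length xs" "cycle_edges xs \<subseteq> insert e T"
      "e \<in> cycle_edges xs"
      using ex_cycle_through[of x y T] e eF by blast
    have "cycle_edges xs \<subseteq> ?F"
      using xs(3) eF T(1) by blast
    then have "cycle_edges xs \<in> cycles G"
      unfolding cycles_def using xs(1,2) by blast
    then show ?thesis
      using xs by blast
  qed
  \<comment> \<open>The cycles closed by \<open>e\<close> and \<open>f\<close> lie in one component
    and hence coincide, but the cycle of \<open>f\<close> has no edge outside \<open>T\<close>
    except \<open>f\<close>.\<close>
  have apart: "e = f" if e: "e \<in> ?F - T" and f: "f \<in> ?F - T" and ef: "(r e, r f) \<in> conn T" for e f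
  proof -
    obtain X where X: "X \<in> cycles G" "e \<in> X" "X \<subseteq> insert e T"
      using ex_cycle[OF e] by blast
    obtain Y where Y: "Y \<in> cycles G" "f \<in> Y" "Y \<subseteq> insert f T"
      using ex_cycle[OF f] by blast
    have "conn T \<subseteq> conn ?F"
      using T(1) by (rule conn_mono)
    let ?C = "component_of G (r e)"
    have in_C: "Z \<in> cycles ?C" if "Z \<in> cycles G" "g \<in> Z" "(r e, r g) \<in> conn T" "g \<in> ?F" for Z g
    proof -
      obtain xs where xs: "Z = cycle_edges xs" "distinct xs" "3 \<le> length xs" "cycle_edges xs \<subseteq> ?F"
        using \<open>Z \<in> cycles G\<close> unfolding cycles_def by blast
      have "(r e, v) \<in> conn ?F" if "h \<in> Z" "v \<in> h" for h v
      proof -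
        have "(r g, v) \<in> conn ?F"
          using cycle_connected[OF xs(4), of g h "r g" v] that \<open>g \<in> Z\<close> r[OF \<open>g \<in> ?F\<close>] xs(1) by simp
        then show ?thesis
          using \<open>(r e, r g) \<in> conn T\<close> \<open>conn T \<subseteq> conn ?F\<close> by (meson conn_trans subsetD)
      qed
      then have "cycle_edges xs \<subseteq> edges ?C"
        using xs(1,4) by auto
      then show ?thesis
        unfolding cycles_def using xs(1-3) by blast
    qed
    have "r e \<in> verts G"
      using r[of e] e G unfolding simple_graph_def by blast
    then have "?C \<in> components G"
      unfolding components_def by simp
    moreover have "X \<in> cycles ?C" "Y \<in> cycles ?C"
      using in_C[OF X(1,2)] in_C[OF Y(1,2) ef] e f by simp_all
    ultimately have "X = Y"
      using \<open>pseudoforest G\<close> unfolding pseudoforest_def by blast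
    then show ?thesis
      using X(2) Y(3) e by blast
  qed
  have "\<exists>t. inj_on t T \<and> (\<forall>e\<in>T. t e \<in> e \<and> t e \<notin> r ` (?F - T))"
  proof (rule indep_ex_tails[OF finite_subset[OF T(1) fin] T(2)])
    show "x = y" if "x \<in> r ` (?F - T)" "y \<in> r ` (?F - T)" "(x, y) \<in> conn T" for x y
      using that apart by blast
  qed
  then obtain t where t: "inj_on t T" "\<forall>e\<in>T. t e \<in> e \<and> t e \<notin> r ` (?F - T)"
    by blast
  \<comment> \<open>Equal ends are trivially connected, so \<open>apart\<close> also yields
    injectivity.\<close>
  have inj_r: "inj_on r (?F - T)"
    using apart conn_refl by (metis inj_onI)
  let ?t = "\<lambda>e. if e \<in> T then t e else r e"
  have "inj_on ?t ?F"
  proof (rule inj_onI)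
    fix e f assume ef: "e \<in> ?F" "f \<in> ?F" "?t e = ?t f"
    then have "e \<in> T \<longleftrightarrow> f \<in> T"
      using t(2) by (metis DiffI imageI)
    then show "e = f"
      using ef inj_onD[OF t(1), of e f] inj_onD[OF inj_r, of e f] by (cases "e \<in> T") simp_all
  qed
  moreover have "\<forall>e\<in>?F. ?t e \<in> e"
    using t(2) r by simp
  ultimately show ?thesis
    by (intro exI[of _ ?t] conjI)
qed

text \<open>Two different cycles in a component with vertex set \<open>?K\<close> would allow two
  edges to be deleted without disconnecting it, so it would have at least \<open>card ?K + 1\<close>
  edges; injective tails allow at most \<open>card ?K\<close>.\<close>

lemma pseudoforest_if_tails:
  assumes G: "simple_graph G" and t: "inj_on t (edges G)" "\<forall>e\<in>edges G. t e \<in> e"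
  shows "pseudoforest G"
  unfolding pseudoforest_def
proof (intro ballI)
  fix C X Y assume "C \<in> components G" and XY: "X \<in> cycles C" "Y \<in> cycles C"
  then obtain v where C: "C = component_of G v" "v \<in> verts G"
    unfolding components_def by blast
  let ?F = "edges G"
  let ?K = "verts C" and ?FK = "edges C"
  have fin: "finite ?FK"
    using simple_graph_finite_edges[OF G] C(1) by simp
  have K: "(u, v) \<in> conn ?FK" if "u \<in> ?K" for u
  proof -
    have "(v, u) \<in> conn ?F"
      using that C(1) by simp
    then have "(v, u) \<in> conn {e \<in> ?F. e \<subseteq> conn ?F `` {v}}"
      by (rule conn_in_component) simp
    then show ?thesis
      unfolding C(1) component_of_simps by (rule conn_sym)
  qed
  have sub: "X \<subseteq> Y" if X: "X \<in> cycles C" and Y: "Y \<in> cycles C" for X Y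
  proof
    fix e assume e: "e \<in> X"
    show "e \<in> Y"
    proof (rule ccontr)
      assume "e \<notin> Y"
      obtain xs where xs: "X = cycle_edges xs" "distinct xs" "3 \<le> length xs" "X \<subseteq> ?FK"
        using X unfolding cycles_def by blast
      obtain ys where ys: "Y = cycle_edges ys" "distinct ys" "3 \<le> length ys" "Y \<subseteq> ?FK"
        using Y unfolding cycles_def by blast
      obtain f where f: "f \<in> Y"
        using ys(1,3) unfolding cycle_edges_def by fastforce
      have "e \<in> edge_cl (X - {e})" "f \<in> edge_cl (Y - {f})"
        using cycle_edge_in_cl xs ys e f by blast+
      \<comment> \<open>\<open>X\<close> makes \<open>e\<close> redundant. Since \<open>Y\<close>
        avoids \<open>e\<close>, it makes \<open>f\<close> redundant even after \<open>e\<close> is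
        gone.\<close>
      then have ef: "e \<in> edge_cl (?FK - {e})" "f \<in> edge_cl (?FK - {e} - {f})"
        using edges.mono[of "X - {e}" "?FK - {e}"] edges.mono[of "Y - {f}" "?FK - {e} - {f}"]
          xs(4) ys(4) \<open>e \<notin> Y\<close> by blast+
      have cl: "?FK - {e} \<subseteq> edge_cl (?FK - {e} - {f})"
        using ef(2) edges.extensive[of "?FK - {e} - {f}"] by blast
      then have "?FK \<subseteq> edge_cl (?FK - {e} - {f})"
        using ef(1) edges.cl_least[OF cl] by blast
      then have "(u, v) \<in> conn (?FK - {e} - {f})" if "u \<in> ?K" for u
        using K[OF that] by (rule conn_least)
      then have K2: "finite ?K" "card ?K \<le> card (?FK - {e} - {f}) + 1"
        using finite_connected_card_le[of "?FK - {e} - {f}" ?K v] fin by blast+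
      have "card ?FK \<le> card ?K"
      proof (rule card_inj_on_le)
        show "inj_on t ?FK"
          using t(1) C(1) by (auto intro: inj_on_subset)
        show "t ` ?FK \<subseteq> ?K"
          using t(2) C(1) by auto
      qed (rule K2(1))
      moreover have "card (?FK - {e} - {f}) + 2 = card ?FK"
      proof -
        have "e \<in> ?FK" "f \<in> ?FK - {e}"
          using e f xs(4) ys(4) \<open>e \<notin> Y\<close> by auto
        then show ?thesis
          using fin card_Suc_Diff1[of ?FK e] card_Suc_Diff1[of "?FK - {e}" f] by simp
      qed
      ultimately show False
        using K2(2) by linarith
    qed
  qed
  show "X = Y"
    using sub XY by blast
qed

lemma forest_if_indep:
  assumes "edges.indep (edges G)"
  shows "forest G"
  unfolding forest_def
proof (rule ccontr)
  assume "cycles G \<noteq> {}"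
  then obtain xs where xs: "distinct xs" "3 \<le> length xs" "cycle_edges xs \<subseteq> edges G"
    unfolding cycles_def by blast
  then obtain e where e: "e \<in> cycle_edges xs"
    unfolding cycle_edges_def by fastforce
  have "edge_cl (cycle_edges xs - {e}) \<subseteq> edge_cl (edges G - {e})"
    using xs(3) by (intro edges.mono) blast
  then have "e \<in> edge_cl (edges G - {e})"
    using cycle_edge_in_cl[OF xs(1,2) e] by blast
  then show False
    using assms e xs(3) unfolding edges.indep_def by blast
qed

lemma pseudoforest_if_forest: "forest G \<Longrightarrow> pseudoforest G"
proof -
  have "cycles (component_of G v) \<subseteq> cycles G" for v
    unfolding cycles_def by auto
  then show "forest G \<Longrightarrow> pseudoforest G"
    unfolding forest_def pseudoforest_def components_def by blast
qed

section \<open>Pseudoarboricity as the least possible maximum out-degree\<close>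

section \<open>Orientations and pseudoarboricity\<close>

lemma orientation_edge: "\<lbrakk>orientation G D; (u, v) \<in> D\<rbrakk> \<Longrightarrow> {u, v} \<in> edges G"
  unfolding orientation_def by blast

lemma orientation_asym: "\<lbrakk>orientation G D; (u, v) \<in> D\<rbrakk> \<Longrightarrow> (v, u) \<notin> D"
  unfolding orientation_def by blast

lemma orientation_total: "\<lbrakk>orientation G D; {u, v} \<in> edges G; (u, v) \<notin> D\<rbrakk> \<Longrightarrow> (v, u) \<in> D"
  unfolding orientation_def by blast

lemma orientation_verts:
  assumes "simple_graph G" "orientation G D" "(u, v) \<in> D"
  shows "u \<in> verts G" "v \<in> verts G" "u \<noteq> v"
proof -
  have "{u, v} \<subseteq> verts G" "card {u, v} = 2"
    using assms(1) orientation_edge[OF assms(2,3)] unfolding simple_graph_def by blast+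
  then show "u \<in> verts G" "v \<in> verts G" "u \<noteq> v"
    by auto
qed

lemma orientation_finite:
  assumes "simple_graph G" "orientation G D"
  shows "finite D"
proof (rule finite_subset)
  show "D \<subseteq> verts G \<times> verts G"
    using orientation_verts[OF assms] by auto
  show "finite (verts G \<times> verts G)"
    using assms(1) unfolding simple_graph_def by simp
qed

lemma finite_out: "finite D \<Longrightarrow> finite {w. (v, w) \<in> D}"
  using finite_Image[of D "{v}"] by (simp add: Image_singleton)

lemma finite_in: "finite D \<Longrightarrow> finite {u. (u, v) \<in> D}"
  using finite_Image[of "D\<inverse>" "{v}"] by (simp add: Image_singleton)

lemma orientation_from_tails:
  assumes "simple_graph G" "\<forall>e\<in>edges G. t e \<in> e"
  shows "orientation G {(u, v). {u, v} \<in> edges G \<and> t {u, v} = u}"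
  unfolding orientation_def
proof (intro conjI allI impI)
  fix u v assume uv: "{u, v} \<in> edges G"
  then have "card {u, v} = 2" "t {u, v} \<in> {u, v}"
    using assms unfolding simple_graph_def by blast+
  then have "u \<noteq> v" "t {u, v} = u \<or> t {u, v} = v"
    by auto
  then show "(u, v) \<in> {(u, v). {u, v} \<in> edges G \<and> t {u, v} = u} \<longleftrightarrow>
      (v, u) \<notin> {(u, v). {u, v} \<in> edges G \<and> t {u, v} = u}"
    using uv by (auto simp: insert_commute)
qed simp

lemma ex_orientation:
  assumes "simple_graph G"
  shows "\<exists>D. orientation G D"
proof -
  have "\<forall>e\<in>edges G. (SOME v. v \<in> e) \<in> e"
    using assms unfolding simple_graph_def by (metis card.empty some_in_eq zero_neq_numeral)
  from orientation_from_tails[OF assms this] show ?thesis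
    by (rule exI)
qed

text \<open>The pseudoforests may overlap, so each edge first chooses one of them,
  \<open>c e\<close>, and takes its tail there. Two arcs out of \<open>v\<close> with the same
  choice would share a tail in one pseudoforest, so there are at most \<open>k\<close>.\<close>

lemma pseudoforest_cover_imp_orientation:
  assumes G: "simple_graph G" and F: "covers k F G" "\<forall>i<k. pseudoforest (F i)"
  shows "\<exists>D. orientation G D \<and> (\<forall>v. out_degree D v \<le> k)"
proof -
  have "\<forall>i\<in>{..<k}. \<exists>t. inj_on t (edges (F i)) \<and> (\<forall>e\<in>edges (F i). t e \<in> e)"
    using F pseudoforest_ex_tails unfolding covers_def subgraph_def by blast
  then obtain t where t: "\<And>i. i < k \<Longrightarrow> inj_on (t i) (edges (F i))"
    "\<And>i e. \<lbrakk>i < k; e \<in> edges (F i)\<rbrakk> \<Longrightarrow> t i e \<in> e"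
    by (metis lessThan_iff)
  have "\<forall>e\<in>edges G. \<exists>i. i < k \<and> e \<in> edges (F i)"
    using F(1) unfolding covers_def by blast
  then obtain c where c: "\<And>e. e \<in> edges G \<Longrightarrow> c e < k \<and> e \<in> edges (F (c e))"
    by metis
  define s where "s e = t (c e) e" for e
  define D where "D = {(u, v). {u, v} \<in> edges G \<and> s {u, v} = u}"
  have "orientation G D"
    unfolding D_def s_def using c t(2) by (intro orientation_from_tails[OF G]) blast
  moreover have "out_degree D v \<le> k" for v
  proof -
    let ?N = "{w. (v, w) \<in> D}"
    have "inj_on (\<lambda>w. c {v, w}) ?N"
    proof (rule inj_onI)
      fix w w' assume w: "w \<in> ?N" "w' \<in> ?N" "c {v, w} = c {v, w'}"
      then have "{v, w} \<in> edges G" "{v, w'} \<in> edges G" "s {v, w} = s {v, w'}"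
        unfolding D_def by auto
      then have "{v, w} = {v, w'}"
        using t(1) c w(3) unfolding s_def by (metis inj_onD)
      then show "w = w'"
        by (auto simp: doubleton_eq_iff)
    qed
    moreover have "(\<lambda>w. c {v, w}) ` ?N \<subseteq> {..<k}"
      using c unfolding D_def by auto
    ultimately have "card ?N \<le> card {..<k}"
      by (rule card_inj_on_le) simp
    then show ?thesis
      unfolding out_degree_def by simp
  qed
  ultimately show ?thesis by blast
qed

text \<open>The arcs out of each vertex are numbered injectively below \<open>k\<close>. Edges with
  the same number have distinct tails, which characterises pseudoforests.\<close>

lemma orientation_imp_pseudoforest_cover:
  assumes G: "simple_graph G" and D: "orientation G D" "\<forall>v\<in>verts G. out_degree D v \<le> k"
  shows "\<exists>F. covers k F G \<and> (\<forall>i<k. pseudoforest (F i))"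
proof -
  note finD = orientation_finite[OF G D(1)]
  have "\<exists>f. inj_on f {w. (v, w) \<in> D} \<and> f ` {w. (v, w) \<in> D} \<subseteq> {..<k}" for v
  proof (cases "v \<in> verts G")
    case True
    then have "card {w. (v, w) \<in> D} \<le> card {..<k}"
      using D(2) unfolding out_degree_def by simp
    then show ?thesis
      using inj_on_iff_card_le[OF finite_out[OF finD] finite_lessThan] by blast
  next
    case False
    then have "{w. (v, w) \<in> D} = {}"
      using orientation_verts[OF G D(1)] by blast
    then show ?thesis by simp
  qed
  then obtain f where f: "\<And>v. inj_on (f v) {w. (v, w) \<in> D}"
    "\<And>v. f v ` {w. (v, w) \<in> D} \<subseteq> {..<k}"
    by metis
  define F where "F i = \<lparr>verts = verts G, edges = {{v, w} | v w. (v, w) \<in> D \<and> f v w = i}\<rparr>" for i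
  \<comment> \<open>Recovers the tail from the unordered edge; asymmetry of \<open>D\<close> leaves
    only one candidate.\<close>
  define t where "t e = (SOME v. \<exists>w. (v, w) \<in> D \<and> e = {v, w})" for e
  have t: "t {v, w} = v" if vw: "(v, w) \<in> D" for v w
  proof -
    have "\<exists>u x. (u, x) \<in> D \<and> {v, w} = {u, x}"
      using vw by blast
    then have "\<exists>x. (t {v, w}, x) \<in> D \<and> {v, w} = {t {v, w}, x}"
      unfolding t_def by (rule someI_ex)
    then show ?thesis
      using orientation_asym[OF D(1) vw] by (auto simp: doubleton_eq_iff)
  qed
  have sub: "subgraph (F i) G" for i
  proof -
    have "edges (F i) \<subseteq> edges G"
      using orientation_edge[OF D(1)] unfolding F_def by auto
    moreover have "verts (F i) = verts G"
      unfolding F_def by simp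
    ultimately show ?thesis
      using G unfolding subgraph_def simple_graph_def by auto
  qed
  have "edges G \<subseteq> (\<Union>i<k. edges (F i))"
  proof
    fix e assume e: "e \<in> edges G"
    obtain x y where xy: "e = {x, y}"
      using simple_graph_edge[OF G e] by blast
    then have "(x, y) \<in> D \<or> (y, x) \<in> D"
      using orientation_total[OF D(1), of x y] e by metis
    then obtain v w where vw: "(v, w) \<in> D" "e = {v, w}"
      using xy by (metis insert_commute)
    then have "f v w < k"
      using f(2)[of v] by blast
    then show "e \<in> (\<Union>i<k. edges (F i))"
      using vw unfolding F_def by auto
  qed
  then have "covers k F G"
    using sub unfolding covers_def subgraph_def by blast
  moreover have "pseudoforest (F i)" for i
  proof (rule pseudoforest_if_tails)
    show "simple_graph (F i)"
      using sub unfolding subgraph_def by blast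
    show "\<forall>e\<in>edges (F i). t e \<in> e"
      using t unfolding F_def by auto
    show "inj_on t (edges (F i))"
    proof (rule inj_onI)
      fix e e' assume "e \<in> edges (F i)" "e' \<in> edges (F i)" and eq: "t e = t e'"
      then obtain v w v' w' where vw: "(v, w) \<in> D" "f v w = i" "e = {v, w}"
        "(v', w') \<in> D" "f v' w' = i" "e' = {v', w'}"
        unfolding F_def by auto
      then have "v = v'"
        using eq t by metis
      then show "e = e'"
        using vw inj_onD[OF f(1)[of v], of w w'] by simp
    qed
  qed
  ultimately show ?thesis by blast
qed

lemma out_degree_le_card_verts:
  assumes "simple_graph G" "orientation G D"
  shows "out_degree D v \<le> card (verts G)"
  unfolding out_degree_def
  using assms(1) orientation_verts[OF assms] unfolding simple_graph_def by (intro card_mono) auto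

lemma pseudoarboricity_le_iff:
  assumes "simple_graph G"
  shows "pseudoarboricity G \<le> k \<longleftrightarrow>
    (\<exists>D. orientation G D \<and> (\<forall>v\<in>verts G. out_degree D v \<le> k))"
proof
  assume le: "pseudoarboricity G \<le> k"
  \<comment> \<open>Some cover has to exist before \<open>LEAST\<close> can be evaluated. Any
    orientation yields one, with the crude bound \<open>card (verts G)\<close>.\<close>
  obtain D where "orientation G D"
    using ex_orientation[OF assms] by blast
  then have "\<exists>n F. covers n F G \<and> (\<forall>i<n. pseudoforest (F i))"
    using orientation_imp_pseudoforest_cover[OF assms] out_degree_le_card_verts[OF assms] by metis
  then have "\<exists>F. covers (pseudoarboricity G) F G \<and> (\<forall>i<pseudoarboricity G. pseudoforest (F i))"
    unfolding pseudoarboricity_def by (rule LeastI_ex)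
  then obtain D where "orientation G D" "\<forall>v. out_degree D v \<le> pseudoarboricity G"
    using pseudoforest_cover_imp_orientation[OF assms] by blast
  then show "\<exists>D. orientation G D \<and> (\<forall>v\<in>verts G. out_degree D v \<le> k)"
    using le le_trans by blast
next
  assume "\<exists>D. orientation G D \<and> (\<forall>v\<in>verts G. out_degree D v \<le> k)"
  then have "\<exists>F. covers k F G \<and> (\<forall>i<k. pseudoforest (F i))"
    using orientation_imp_pseudoforest_cover[OF assms] by blast
  then show "pseudoarboricity G \<le> k"
    unfolding pseudoarboricity_def by (rule Least_le)
qed

section \<open>Local star arboricity as the least possible maximum of
  \<open>star_load\<close>\<close>

section \<open>Orientations and local star arboricity\<close>

text \<open>The number of stars containing \<open>v\<close> when the arcs entering each head \<open>c\<close> form a star with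
  centre \<open>c\<close>.\<close>

definition star_load :: "('a \<times> 'a) set \<Rightarrow> 'a \<Rightarrow> nat" where
  "star_load D v = out_degree D v + of_bool (v \<in> Range D)"

lemma local_multiplicity_le_iff:
  assumes "simple_graph G"
  shows "local_multiplicity k S G \<le> m \<longleftrightarrow> (\<forall>v\<in>verts G. card {i. i < k \<and> v \<in> verts (S i)} \<le> m)"
  using assms unfolding local_multiplicity_def simple_graph_def by simp

lemma star_forest_star:
  assumes "c \<notin> A"
  shows "star_forest \<lparr>verts = insert c A, edges = (\<lambda>a. {a, c}) ` A\<rparr>"
proof -
  let ?G = "\<lparr>verts = insert c A, edges = (\<lambda>a. {a, c}) ` A\<rparr>"
  let ?F = "(\<lambda>a. {a, c}) ` A"
  have "e \<notin> edge_cl (?F - {e})" if eF: "e \<in> ?F" for e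
  proof
    assume e: "e \<in> edge_cl (?F - {e})"
    obtain a where a: "a \<in> A" "e = {a, c}"
      using eF by blast
    have "(a, c) \<in> conn (?F - {e})"
      by (rule edge_clD) (use e a(2) in simp)
    \<comment> \<open>The invariant is equality with \<open>a\<close>: without its own edge a leaf
      is isolated.\<close>
    then have "c = a"
      by (rule conn_invariant) (use a assms in \<open>auto simp: doubleton_eq_iff\<close>)
    then show False
      using a(1) assms by simp
  qed
  then have "forest ?G"
    by (intro forest_if_indep) (simp add: edges.indep_def)
  moreover have "star C" if C_comp: "C \<in> components ?G" for C
  proof -
    obtain v where v: "v \<in> insert c A" and C: "C = component_of ?G v"
      using C_comp unfolding components_def by auto
    have a: "(a, c) \<in> conn ?F" if "a \<in> insert c A" for a
      using that by (auto intro: conn_edge)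
    have "(v, w) \<in> conn ?F" if "w \<in> insert c A" for w
      using a[OF v] a[OF that] by (meson conn_sym conn_trans)
    moreover have "w \<in> insert c A" if "(v, w) \<in> conn ?F" for w
      using that by (rule conn_invariant) (use v in \<open>auto simp: doubleton_eq_iff\<close>)
    ultimately have K: "conn ?F `` {v} = insert c A"
      by blast
    have "edges C = {{c, w} | w. w \<in> verts C - {c}}"
      using assms K unfolding C by (auto simp: insert_commute)
    moreover have "c \<in> verts C"
      using K unfolding C by simp
    ultimately show ?thesis
      unfolding star_def by blast
  qed
  ultimately show ?thesis
    unfolding star_forest_def by blast
qed

text \<open>The centre \<open>h v\<close> is chosen from the component of \<open>v\<close> alone, so
  all vertices of a star agree on it, even in a single edge where both ends qualify. Being a fixed
  point of \<open>h\<close> then tells centres from leaves.\<close>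

lemma star_forest_ex_centres:
  assumes H: "simple_graph H" "star_forest H"
  shows "\<exists>h. \<forall>e\<in>edges H. \<exists>v. e = {v, h v} \<and> h v \<noteq> v \<and> h (h v) = h v"
proof -
  let ?F = "edges H"
  define h where "h v = (SOME c. c \<in> verts (component_of H v) \<and>
      edges (component_of H v) = {{c, w} | w. w \<in> verts (component_of H v) - {c}})" for v
  have h: "edges (component_of H v) = {{h v, w} | w. w \<in> verts (component_of H v) - {h v}}"
    if "v \<in> verts H" for v
  proof -
    have "\<exists>c. c \<in> verts (component_of H v) \<and>
        edges (component_of H v) = {{c, w} | w. w \<in> verts (component_of H v) - {c}}"
      using H(2) that unfolding star_forest_def star_def components_def by blast
    from someI_ex[OF this] show ?thesis
      unfolding h_def by blast
  qed
  have "\<exists>v. e = {v, h v} \<and> h v \<noteq> v \<and> h (h v) = h v" if e: "e \<in> ?F" for e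
  proof -
    obtain x y where xy: "e = {x, y}" "x \<in> verts H" "y \<in> verts H"
      using simple_graph_edge[OF H(1) e] by blast
    have "(x, y) \<in> conn ?F" "(y, x) \<in> conn ?F"
      using e xy(1) by (auto intro: conn_edge conn_sym)
    then have "conn ?F `` {y} = conn ?F `` {x}"
      by (auto intro: conn_trans)
    then have "component_of H y = component_of H x"
      by (simp add: component_of_def conn_def)
    then have "h y = h x"
      unfolding h_def by simp
    have "e \<in> edges (component_of H x)"
      using e xy(1) \<open>(x, y) \<in> conn ?F\<close> by simp
    then obtain w where "e = {h x, w}" "w \<noteq> h x"
      using h[OF xy(2)] by blast
    then show ?thesis
      using xy(1) \<open>h y = h x\<close> by (intro exI[of _ w]) (auto simp: doubleton_eq_iff)
  qed
  then show ?thesis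
    by (intro exI[of _ h] ballI)
qed

lemma orientation_imp_star_cover:
  assumes G: "simple_graph G" and D: "orientation G D" "\<forall>v\<in>verts G. star_load D v \<le> m"
  shows "\<exists>k S. covers k S G \<and> (\<forall>i<k. star_forest (S i)) \<and> local_multiplicity k S G \<le> m"
proof -
  note finD = orientation_finite[OF G D(1)]
  let ?H = "Range D"
  let ?k = "card ?H"
  have "finite ?H"
    using finD by (rule finite_Range)
  then obtain c where c: "bij_betw c {..<?k} ?H"
    using ex_bij_betw_nat_finite by (metis atLeast0LessThan)
  define S where "S i = \<lparr>verts = insert (c i) {u. (u, c i) \<in> D},
      edges = (\<lambda>u. {u, c i}) ` {u. (u, c i) \<in> D}\<rparr>" for i
  have c_head: "\<exists>u. (u, c i) \<in> D" if "i < ?k" for i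
    using c that unfolding bij_betw_def by blast
  have "star_forest (S i)" for i
    unfolding S_def using orientation_verts(3)[OF G D(1)] by (intro star_forest_star) blast
  moreover have "subgraph (S i) G" if "i < ?k" for i
  proof -
    have "verts (S i) \<subseteq> verts G"
      using c_head[OF that] orientation_verts[OF G D(1)] unfolding S_def by auto
    moreover have "edges (S i) \<subseteq> edges G"
      using orientation_edge[OF D(1)] unfolding S_def by auto
    moreover have "\<forall>e\<in>edges (S i). e \<subseteq> verts (S i)"
      unfolding S_def by auto
    ultimately show ?thesis
      using G unfolding subgraph_def simple_graph_def by (auto intro: finite_subset)
  qed
  moreover have "edges G \<subseteq> (\<Union>i<?k. edges (S i))"
  proof
    fix e assume e: "e \<in> edges G"
    obtain x y where xy: "e = {x, y}"
      using simple_graph_edge[OF G e] by blast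
    then have "(x, y) \<in> D \<or> (y, x) \<in> D"
      using orientation_total[OF D(1), of x y] e by metis
    then obtain u v where uv: "(u, v) \<in> D" "e = {u, v}"
      using xy by (metis insert_commute)
    then obtain i where "i < ?k" "c i = v"
      using c unfolding bij_betw_def by (metis Range.intros imageE lessThan_iff)
    then show "e \<in> (\<Union>i<?k. edges (S i))"
      using uv unfolding S_def by auto
  qed
  moreover have "card {i. i < ?k \<and> v \<in> verts (S i)} \<le> m" if v: "v \<in> verts G" for v
  proof -
    let ?I = "{i. i < ?k \<and> v \<in> verts (S i)}"
    let ?O = "{w. (v, w) \<in> D}"
    \<comment> \<open>Stars are told apart by their centres, so counting the stars at
      \<open>v\<close> amounts to counting their centres.\<close>
    have "inj_on c ?I"
      using c unfolding bij_betw_def by (auto intro: inj_on_subset)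
    moreover have "c ` ?I \<subseteq> ?O \<union> ({v} \<inter> Range D)"
      using c_head unfolding S_def by auto
    ultimately have "card ?I \<le> card (?O \<union> ({v} \<inter> Range D))"
      using finite_out[OF finD] by (intro card_inj_on_le) auto
    also have "\<dots> \<le> card ?O + card ({v} \<inter> Range D)"
      by (rule card_Un_le)
    also have "\<dots> = star_load D v"
      unfolding star_load_def out_degree_def by simp
    also have "\<dots> \<le> m"
      using D(2) v by blast
    finally show ?thesis .
  qed
  ultimately have "covers ?k S G \<and> (\<forall>i<?k. star_forest (S i)) \<and> local_multiplicity ?k S G \<le> m"
    unfolding covers_def local_multiplicity_le_iff[OF G] subgraph_def by blast
  then show ?thesis by blast
qed

text \<open>Each edge is directed from leaf to centre in one star forest chosen for it. An index in
  which \<open>v\<close> is a leaf determines the centre, so the arcs out of \<open>v\<close> use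
  distinct such indices; if \<open>v\<close> is a head, it is a centre for some further index, which
  pays for the extra unit in \<open>star_load\<close>.\<close>

lemma star_cover_imp_orientation:
  assumes G: "simple_graph G"
    and S: "covers k S G" "\<forall>i<k. star_forest (S i)" "local_multiplicity k S G \<le> m"
  shows "\<exists>D. orientation G D \<and> (\<forall>v\<in>verts G. star_load D v \<le> m)"
proof -
  have simple: "simple_graph (S i)" if "i < k" for i
    using S(1) that unfolding covers_def subgraph_def by blast
  have "\<forall>i\<in>{..<k}. \<exists>h. \<forall>e\<in>edges (S i). \<exists>v. e = {v, h v} \<and> h v \<noteq> v \<and> h (h v) = h v"
    using S(2) simple star_forest_ex_centres by blast
  then obtain h where h: "\<And>i e. \<lbrakk>i < k; e \<in> edges (S i)\<rbrakk> \<Longrightarrow>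
      \<exists>v. e = {v, h i v} \<and> h i v \<noteq> v \<and> h i (h i v) = h i v"
    by (metis lessThan_iff)
  have "\<forall>e\<in>edges G. \<exists>i. i < k \<and> e \<in> edges (S i)"
    using S(1) unfolding covers_def by blast
  then obtain c where c: "\<And>e. e \<in> edges G \<Longrightarrow> c e < k \<and> e \<in> edges (S (c e))"
    by metis
  have "\<forall>e\<in>edges G. \<exists>v. e = {v, h (c e) v} \<and> h (c e) v \<noteq> v \<and>
      h (c e) (h (c e) v) = h (c e) v"
    using h c by blast
  then obtain t where t: "\<And>e. e \<in> edges G \<Longrightarrow> e = {t e, h (c e) (t e)}"
    "\<And>e. e \<in> edges G \<Longrightarrow> h (c e) (t e) \<noteq> t e"
    "\<And>e. e \<in> edges G \<Longrightarrow> h (c e) (h (c e) (t e)) = h (c e) (t e)"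
    by metis
  define D where "D = {(u, v). {u, v} \<in> edges G \<and> t {u, v} = u}"
  have "\<forall>e\<in>edges G. t e \<in> e"
    using t(1) by blast
  then have or: "orientation G D"
    unfolding D_def by (rule orientation_from_tails[OF G])
  have arc: "c {u, v} < k" "u \<in> verts (S (c {u, v}))" "v \<in> verts (S (c {u, v}))"
    "h (c {u, v}) u = v" "h (c {u, v}) v = v" if uv: "(u, v) \<in> D" for u v
  proof -
    have e: "{u, v} \<in> edges G" "t {u, v} = u"
      using uv unfolding D_def by auto
    show "c {u, v} < k"
      using c e(1) by blast
    then show "u \<in> verts (S (c {u, v}))" "v \<in> verts (S (c {u, v}))"
      using c[OF e(1)] simple unfolding simple_graph_def by blast+
    show *: "h (c {u, v}) u = v"
      using t(1)[OF e(1)] t(2)[OF e(1)] unfolding e(2) by (auto simp: doubleton_eq_iff)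
    show "h (c {u, v}) v = v"
      using t(3)[OF e(1)] unfolding e(2) * .
  qed
  have "star_load D v \<le> m" if v: "v \<in> verts G" for v
  proof -
    let ?O = "{w. (v, w) \<in> D}"
    let ?I = "{i. i < k \<and> v \<in> verts (S i)}"
    let ?L = "{i \<in> ?I. h i v \<noteq> v}"
    have "inj_on (\<lambda>w. c {v, w}) ?O"
      using arc(4) by (intro inj_onI) (metis mem_Collect_eq)
    moreover have "(\<lambda>w. c {v, w}) ` ?O \<subseteq> ?L"
      using arc orientation_verts(3)[OF G or] by fastforce
    ultimately have O: "card ?O \<le> card ?L"
      by (intro card_inj_on_le) auto
    have "card ?L + of_bool (v \<in> Range D) \<le> card ?I"
    proof (cases "v \<in> Range D")
      case True
      then obtain u where "(u, v) \<in> D"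
        by blast
      then have "c {u, v} \<in> ?I - ?L"
        using arc by blast
      then have "?L \<subset> ?I"
        by blast
      then have "card ?L < card ?I"
        by (intro psubset_card_mono) simp_all
      then show ?thesis
        using True by simp
    qed (auto intro: card_mono)
    also have "\<dots> \<le> m"
      using S(3) v unfolding local_multiplicity_le_iff[OF G] by blast
    finally show ?thesis
      using O unfolding star_load_def out_degree_def by linarith
  qed
  then show ?thesis
    using or by blast
qed

lemma local_star_arboricity_le_iff:
  assumes "simple_graph G"
  shows "local_star_arboricity G \<le> m \<longleftrightarrow>
    (\<exists>D. orientation G D \<and> (\<forall>v\<in>verts G. star_load D v \<le> m))"
proof
  assume le: "local_star_arboricity G \<le> m"
  obtain D where D: "orientation G D"
    using ex_orientation[OF assms] by blast
  \<comment> \<open>A crude bound for an arbitrary orientation, which guarantees that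
    \<open>LEAST\<close> ranges over a nonempty set.\<close>
  have "\<forall>v\<in>verts G. star_load D v \<le> card (verts G) + 1"
    using out_degree_le_card_verts[OF assms D] unfolding star_load_def
    by (intro ballI add_mono) auto
  then have "\<exists>m k S. covers k S G \<and> (\<forall>i<k. star_forest (S i)) \<and> m = local_multiplicity k S G"
    using orientation_imp_star_cover[OF assms D] by blast
  then have "\<exists>k S. covers k S G \<and> (\<forall>i<k. star_forest (S i)) \<and>
      local_star_arboricity G = local_multiplicity k S G"
    unfolding local_star_arboricity_def by (rule LeastI_ex)
  then show "\<exists>D. orientation G D \<and> (\<forall>v\<in>verts G. star_load D v \<le> m)"
    using star_cover_imp_orientation[OF assms] le by metis
next
  assume "\<exists>D. orientation G D \<and> (\<forall>v\<in>verts G. star_load D v \<le> m)"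
  then obtain k S where S: "covers k S G" "\<forall>i<k. star_forest (S i)" "local_multiplicity k S G \<le> m"
    using orientation_imp_star_cover[OF assms] by blast
  have "local_star_arboricity G \<le> local_multiplicity k S G"
    unfolding local_star_arboricity_def using S(1,2) by (intro Least_le) blast
  then show "local_star_arboricity G \<le> m"
    using S(3) by linarith
qed

section \<open>From edge counts to forests, and the equality case\<close>

section \<open>Arboricity and local star arboricity\<close>

text \<open>Each vertex of \<open>W\<close> sends at most \<open>m\<close> arcs, one fewer if it is a head, and it sends at most
  \<open>t\<close> arcs, again one fewer if it is a head, where \<open>t\<close> is the number of heads in \<open>W\<close>. So there
  are at most \<open>min m t * card W - t\<close> arcs inside \<open>W\<close>.\<close>

lemma card_edges_inside_le:
  assumes G: "simple_graph G" and D: "orientation G D" "\<forall>v\<in>verts G. star_load D v \<le> m"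
    and W: "W \<subseteq> verts G" "W \<noteq> {}"
  shows "card {e \<in> edges G. e \<subseteq> W} \<le> m * (card W - 1)"
proof -
  note finD = orientation_finite[OF G D(1)]
  have finW: "finite W"
    using G W(1) finite_subset unfolding simple_graph_def by blast
  define Out where "Out v = {w \<in> W. (v, w) \<in> D}" for v
  define H where "H = {w \<in> W. \<exists>v\<in>W. (v, w) \<in> D}"
  let ?E = "{e \<in> edges G. e \<subseteq> W}"
  let ?t = "card H"
  let ?b = "min m ?t"
  have fin: "finite H" "\<And>v. finite (Out v)"
    unfolding H_def Out_def using finW by simp_all
  have "?E \<subseteq> (\<lambda>(v, w). {v, w}) ` Sigma W Out"
  proof
    fix e assume e: "e \<in> ?E"
    then obtain x y where xy: "e = {x, y}"
      using simple_graph_edge[OF G] by blast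
    then have "(x, y) \<in> D \<or> (y, x) \<in> D"
      using orientation_total[OF D(1), of x y] e by blast
    then show "e \<in> (\<lambda>(v, w). {v, w}) ` Sigma W Out"
      using e xy unfolding Out_def by (auto simp: image_iff insert_commute)
  qed
  then have "card ?E \<le> card (Sigma W Out)"
    using finW fin(2) by (intro surj_card_le) auto
  also have "\<dots> = (\<Sum>v\<in>W. card (Out v))"
    using finW fin(2) by (intro card_SigmaI) auto
  finally have E: "card ?E \<le> (\<Sum>v\<in>W. card (Out v))" .
  have "card (Out v) + of_bool (v \<in> H) \<le> ?b" if v: "v \<in> W" for v
  proof -
    have "card (Out v) + of_bool (v \<in> H) \<le> star_load D v"
      unfolding star_load_def out_degree_def
    proof (rule add_mono)
      show "card (Out v) \<le> card {w. (v, w) \<in> D}"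
        unfolding Out_def using finite_out[OF finD] by (intro card_mono) auto
      show "of_bool (v \<in> H) \<le> (of_bool (v \<in> Range D) :: nat)"
        unfolding H_def by auto
    qed
    also have "\<dots> \<le> m"
      using D(2) v W(1) by blast
    finally have "card (Out v) + of_bool (v \<in> H) \<le> m" .
    moreover have "card (Out v) + of_bool (v \<in> H) \<le> ?t"
    proof -
      \<comment> \<open>There are no loops, so a vertex that is itself a head misses at least one
        head among its targets.\<close>
      have "Out v \<subseteq> H - {v}"
        using v orientation_verts(3)[OF G D(1)] unfolding Out_def H_def by blast
      then have "card (Out v) \<le> card (H - {v})"
        using fin(1) by (intro card_mono) simp_all
      moreover have "card (H - {v}) + of_bool (v \<in> H) = ?t"
        using fin(1) card_Suc_Diff1[of H v] by auto
      ultimately show ?thesis by linarith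
    qed
    ultimately show ?thesis by simp
  qed
  then have "(\<Sum>v\<in>W. card (Out v) + of_bool (v \<in> H)) \<le> (\<Sum>v\<in>W. ?b)"
    by (intro sum_mono)
  moreover have "(\<Sum>v\<in>W. of_bool (v \<in> H)) = ?t"
    using finW unfolding H_def by (simp add: of_bool_def sum.If_cases Int_def)
  ultimately have le: "card ?E + ?t \<le> card W * ?b"
    using E by (simp add: sum.distrib)
  obtain n where n: "card W = Suc n"
    using finW W(2) by (cases "card W") auto
  have "card ?E \<le> m * n"
  \<comment> \<open>With \<open>card W = n + 1\<close> the bound \<open>?b * card W - ?t\<close> is
    at most \<open>m * n\<close> if \<open>m\<close> is the minimum, and equals
    \<open>?t * n\<close> otherwise.\<close>
  proof (cases "m \<le> ?t")
    case True
    then show ?thesis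
      using le n by (simp add: mult.commute)
  next
    case False
    then have "card ?E \<le> ?t * n"
      using le n by (simp add: mult.commute)
    also have "\<dots> \<le> m * n"
      using False by simp
    finally show ?thesis .
  qed
  then show ?thesis
    using n by simp
qed

text \<open>In a dense set each of the \<open>m\<close> disjoint classes connects the whole
  component \<open>W\<close> of the spare edge \<open>e\<close>, so it has at least
  \<open>card W - 1\<close> edges there. Together with \<open>e\<close> itself this exceeds the
  sparsity bound.\<close>

lemma sparse_imp_forest_cover:
  assumes G: "simple_graph G"
    and sparse: "\<And>W. \<lbrakk>W \<subseteq> verts G; W \<noteq> {}\<rbrakk> \<Longrightarrow> card {e \<in> edges G. e \<subseteq> W} \<le> m * (card W - 1)"
  shows "\<exists>F. covers m F G \<and> (\<forall>i<m. forest (F i))"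
proof -
  note finE = simple_graph_finite_edges[OF G]
  have no: "\<not> (\<exists>S\<subseteq>edges G. \<exists>e\<in>S. \<exists>c. \<forall>i<m. S \<subseteq> edge_cl {x \<in> S - {e}. c x = i})"
  proof (intro notI, elim exE conjE bexE)
    fix S e and c :: "'a set \<Rightarrow> nat"
    assume S: "S \<subseteq> edges G" "e \<in> S" and dense: "\<forall>i<m. S \<subseteq> edge_cl {x \<in> S - {e}. c x = i}"
    obtain x y where e: "e = {x, y}" "x \<in> verts G"
      using simple_graph_edge[OF G] S by blast
    \<comment> \<open>\<open>S\<close> may be disconnected, and \<open>x\<close> is an end of
      \<open>e\<close>; the component of \<open>e\<close> is the place where the spare edge tips the
      count.\<close>
    define W where "W = conn S `` {x}"
    define A where "A i = {f \<in> {f \<in> S - {e}. c f = i}. f \<subseteq> W}" for i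
    let ?E = "{f \<in> edges G. f \<subseteq> W}"
    have "v \<in> verts G" if "(x, v) \<in> conn S" for v
      using that e(2)
    proof (rule conn_invariant)
      fix u v assume "{u, v} \<in> S"
      then have "{u, v} \<subseteq> verts G"
        using S(1) G unfolding simple_graph_def by blast
      then show "v \<in> verts G" by simp
    qed
    then have W: "W \<subseteq> verts G" "x \<in> W"
      unfolding W_def by auto
    then have finW: "finite W"
      using G finite_subset unfolding simple_graph_def by blast
    have finA: "finite (A i)" for i
      using finE S(1) unfolding A_def by (auto intro: finite_subset[of _ "edges G"])
    have A: "card W - 1 \<le> card (A i)" if i: "i < m" for i
    proof -
      have "(v, x) \<in> conn (A i)" if "v \<in> W" for v
      proof -
        have "S \<subseteq> edge_cl {f \<in> S - {e}. c f = i}"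
          using dense i by blast
        moreover have "(x, v) \<in> conn S"
          using that unfolding W_def by simp
        ultimately have "(x, v) \<in> conn {f \<in> S - {e}. c f = i}"
          by (rule conn_least)
        then have "(x, v) \<in> conn (A i)"
          unfolding A_def W_def by (rule conn_in_component) blast
        then show ?thesis
          by (rule conn_sym)
      qed
      then show ?thesis
        using finite_connected_card_le(2)[OF finA, of W x i] by fastforce
    qed
    have "m * (card W - 1) = (\<Sum>i<m. card W - 1)"
      by simp
    also have "\<dots> \<le> (\<Sum>i<m. card (A i))"
      using A by (intro sum_mono) simp
    also have "\<dots> = card (\<Union>i<m. A i)"
      using finA by (intro card_UN_disjoint[symmetric]) (auto simp: A_def)
    also have "\<dots> \<le> card (?E - {e})"
      using finE S(1) by (intro card_mono) (auto simp: A_def)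
    also have "\<dots> < card ?E"
    proof (rule card_Diff1_less)
      have "(x, y) \<in> conn S"
        using S(2) e(1) by (intro conn_edge) simp
      then show "e \<in> ?E"
        using S e(1) W(2) unfolding W_def by auto
    qed (use finE in simp)
    also have "\<dots> \<le> m * (card W - 1)"
      using W by (intro sparse) auto
    finally show False by simp
  qed
  have "\<exists>c. (\<forall>e\<in>edges G. c e < m) \<and> (\<forall>i<m. edges.indep {e \<in> edges G. c e = i})"
    using edges.coloured_or_dense[OF finE, of m] by (rule disjE) (assumption, erule notE[OF no])
  then obtain c where c: "\<forall>e\<in>edges G. c e < m" "\<forall>i<m. edges.indep {e \<in> edges G. c e = i}"
    by (elim exE conjE)
  let ?F = "\<lambda>i. \<lparr>verts = verts G, edges = {e \<in> edges G. c e = i}\<rparr>"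
  have "covers m ?F G"
    using G c(1) unfolding covers_def subgraph_def simple_graph_def by auto
  moreover have "forest (?F i)" if "i < m" for i
    using c(2) that by (intro forest_if_indep) simp
  ultimately show ?thesis
    by (intro exI[of _ ?F]) simp
qed

lemma ex_forest_cover_local_star_arboricity:
  assumes "simple_graph G"
  shows "\<exists>F. covers (local_star_arboricity G) F G \<and> (\<forall>i<local_star_arboricity G. forest (F i))"
proof -
  obtain D where "orientation G D" "\<forall>v\<in>verts G. star_load D v \<le> local_star_arboricity G"
    using local_star_arboricity_le_iff[OF assms] by blast
  then show ?thesis
    using card_edges_inside_le[OF assms] by (intro sparse_imp_forest_cover[OF assms]) blast
qed

lemma ex_forest_cover_arboricity:
  assumes "simple_graph G"
  shows "\<exists>F. covers (arboricity G) F G \<and> (\<forall>i<arboricity G. forest (F i))"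
proof -
  have "\<exists>k F. covers k F G \<and> (\<forall>i<k. forest (F i))"
    using ex_forest_cover_local_star_arboricity[OF assms] by (rule exI)
  then show ?thesis
    unfolding arboricity_def by (rule LeastI_ex)
qed

lemma arboricity_le_local_star_arboricity:
  assumes "simple_graph G"
  shows "arboricity G \<le> local_star_arboricity G"
  unfolding arboricity_def
  by (rule Least_le) (rule ex_forest_cover_local_star_arboricity[OF assms])

lemma pseudoarboricity_le_arboricity:
  assumes "simple_graph G"
  shows "pseudoarboricity G \<le> arboricity G"
proof -
  have "\<exists>F. covers (arboricity G) F G \<and> (\<forall>i<arboricity G. pseudoforest (F i))"
    using ex_forest_cover_arboricity[OF assms] pseudoforest_if_forest by blast
  then show ?thesis
    unfolding pseudoarboricity_def by (intro Least_le)
qed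

lemma local_star_arboricity_le_Suc_pseudoarboricity:
  assumes "simple_graph G"
  shows "local_star_arboricity G \<le> pseudoarboricity G + 1"
proof -
  obtain D where D: "orientation G D" "\<forall>v\<in>verts G. out_degree D v \<le> pseudoarboricity G"
    using pseudoarboricity_le_iff[OF assms] by blast
  then have "\<forall>v\<in>verts G. star_load D v \<le> pseudoarboricity G + 1"
    unfolding star_load_def by (intro ballI add_mono) auto
  then show ?thesis
    using D(1) local_star_arboricity_le_iff[OF assms] by blast
qed

lemma degree_eq_out_plus_in:
  assumes G: "simple_graph G" and D: "orientation G D"
  shows "degree G v = out_degree D v + card {u. (u, v) \<in> D}"
proof -
  note finD = orientation_finite[OF G D]
  let ?O = "{w. (v, w) \<in> D}" and ?I = "{u. (u, v) \<in> D}"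
  have "{e \<in> edges G. v \<in> e} = (\<lambda>w. {v, w}) ` (?O \<union> ?I)"
  proof
    show "{e \<in> edges G. v \<in> e} \<subseteq> (\<lambda>w. {v, w}) ` (?O \<union> ?I)"
    proof
      fix e assume e: "e \<in> {e \<in> edges G. v \<in> e}"
      then obtain x y where "e = {x, y}"
        using simple_graph_edge[OF G] by blast
      then obtain w where w: "e = {v, w}"
        using e by (auto simp: insert_commute)
      then have "w \<in> ?O \<union> ?I"
        using orientation_total[OF D, of v w] e by blast
      then show "e \<in> (\<lambda>w. {v, w}) ` (?O \<union> ?I)"
        using w by blast
    qed
    show "(\<lambda>w. {v, w}) ` (?O \<union> ?I) \<subseteq> {e \<in> edges G. v \<in> e}"
    proof (rule image_subsetI)
      fix w assume "w \<in> ?O \<union> ?I"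
      then have "{v, w} \<in> edges G"
        using orientation_edge[OF D, of v w] orientation_edge[OF D, of w v]
        by (auto simp: insert_commute)
      then show "{v, w} \<in> {e \<in> edges G. v \<in> e}" by simp
    qed
  qed
  moreover have "inj_on (\<lambda>w. {v, w}) (?O \<union> ?I)"
    by (auto simp: inj_on_def doubleton_eq_iff)
  ultimately have "degree G v = card (?O \<union> ?I)"
    unfolding degree_def by (simp add: card_image)
  also have "\<dots> = card ?O + card ?I"
    using finite_out[OF finD] finite_in[OF finD] orientation_asym[OF D]
    by (intro card_Un_disjoint) auto
  finally show ?thesis
    unfolding out_degree_def .
qed

text \<open>Translates the indicator in \<open>star_load\<close> into the degree condition: a vertex
  of out-degree \<open>p\<close> stays within load \<open>p\<close> exactly if it is no head, that
  is, has degree \<open>p\<close>.\<close>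

lemma out_degree_eq_degree_iff:
  assumes "simple_graph G" "orientation G D"
  shows "out_degree D v = degree G v \<longleftrightarrow> v \<notin> Range D"
  using degree_eq_out_plus_in[OF assms, of v] finite_in[OF orientation_finite[OF assms], of v]
  by auto

lemma local_star_arboricity_eq_pseudoarboricity_iff:
  assumes G: "simple_graph G"
  shows "local_star_arboricity G = pseudoarboricity G \<longleftrightarrow>
    (\<exists>D. orientation G D \<and> max_out_degree G D = pseudoarboricity G \<and>
         (\<forall>v\<in>verts G. out_degree D v = pseudoarboricity G \<longrightarrow> degree G v = pseudoarboricity G))"
    (is "_ \<longleftrightarrow> (\<exists>D. ?P D)")
proof -
  let ?p = "pseudoarboricity G"
  have max_le: "max_out_degree G D \<le> k \<longleftrightarrow> (\<forall>v\<in>verts G. out_degree D v \<le> k)" for D k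
    using G unfolding max_out_degree_def simple_graph_def by simp
  have load: "(\<forall>v\<in>verts G. star_load D v \<le> ?p) \<longleftrightarrow> max_out_degree G D = ?p \<and>
      (\<forall>v\<in>verts G. out_degree D v = ?p \<longrightarrow> degree G v = ?p)" if D: "orientation G D" for D
  proof -
    \<comment> \<open>No orientation has maximum out-degree below \<open>?p\<close>, so an upper
      bound by \<open>?p\<close> is already equality.\<close>
    have "max_out_degree G D = ?p \<longleftrightarrow> (\<forall>v\<in>verts G. out_degree D v \<le> ?p)"
      using pseudoarboricity_le_iff[OF G, of "max_out_degree G D"] max_le D by (metis order.eq_iff)
    moreover have "star_load D v \<le> ?p \<longleftrightarrow> out_degree D v \<le> ?p \<and>
        (out_degree D v = ?p \<longrightarrow> degree G v = ?p)" for v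
      using out_degree_eq_degree_iff[OF G D, of v] unfolding star_load_def
      by (cases "v \<in> Range D") auto
    ultimately show ?thesis by blast
  qed
  have "local_star_arboricity G = ?p \<longleftrightarrow> local_star_arboricity G \<le> ?p"
    using pseudoarboricity_le_arboricity[OF G] arboricity_le_local_star_arboricity[OF G] by linarith
  also have "\<dots> \<longleftrightarrow> (\<exists>D. ?P D)"
    unfolding local_star_arboricity_le_iff[OF G] using load by metis
  finally show ?thesis .
qed

section \<open>Small witnesses for the strict inequalities\<close>

section \<open>Strictness\<close>

lemma triangle_strict:
  fixes G :: "nat graph"
  assumes "G = \<lparr>verts = {0, 1, 2}, edges = {{0, 1}, {1, 2}, {2, 0}}\<rparr>"
  shows "simple_graph G" "pseudoarboricity G < arboricity G"
proof -
  show G: "simple_graph G"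
    unfolding assms simple_graph_def by auto
  let ?D = "{(0, 1), (1, 2), (2, 0)} :: (nat \<times> nat) set"
  have "orientation G ?D"
    unfolding orientation_def assms by (auto simp: doubleton_eq_iff)
  moreover have "out_degree ?D v \<le> 1" for v
  proof -
    \<comment> \<open>The singleton holds the cyclic successor of \<open>v\<close>; for
      \<open>v\<close> outside the triangle it merely contains the empty set.\<close>
    have "{w. (v, w) \<in> ?D} \<subseteq> {if v = 2 then 0 else Suc v}"
      by auto
    from card_mono[OF _ this] show ?thesis
      unfolding out_degree_def by simp
  qed
  ultimately have p: "pseudoarboricity G \<le> 1"
    using pseudoarboricity_le_iff[OF G] by blast
  have "1 < arboricity G"
  proof (rule ccontr)
    assume "\<not> 1 < arboricity G"
    moreover obtain F where F: "covers (arboricity G) F G" "\<forall>i<arboricity G. forest (F i)"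
      using ex_forest_cover_arboricity[OF G] by blast
    \<comment> \<open>An edge that has to be covered excludes arboricity 0.\<close>
    moreover have "{0, 1} \<in> (\<Union>i<arboricity G. edges (F i))"
      using F(1) unfolding covers_def assms by simp
    ultimately have "arboricity G = 1"
      by (cases "arboricity G") auto
    then have "edges (F 0) = edges G" "cycles (F 0) = {}"
      using F unfolding covers_def forest_def by (auto simp: lessThan_Suc)
    moreover have "cycle_edges [0, 1, 2] = edges G"
    proof -
      have "{i. i < length [0, 1, 2::nat]} = {0, 1, 2}"
        by auto
      then show ?thesis
        unfolding cycle_edges_def setcompr_eq_image assms by simp
    qed
    ultimately have "cycle_edges [0, 1, 2] \<in> cycles (F 0)"
      unfolding cycles_def by (auto intro!: exI[of _ "[0, 1, 2]"])
    then show False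
      using \<open>cycles (F 0) = {}\<close> by simp
  qed
  then show "pseudoarboricity G < arboricity G"
    using p by linarith
qed

lemma path_strict:
  fixes G :: "nat graph"
  assumes "G = \<lparr>verts = {0, 1, 2, 3}, edges = {{0, 1}, {1, 2}, {2, 3}}\<rparr>"
  shows "simple_graph G" "arboricity G < local_star_arboricity G"
proof -
  show G: "simple_graph G"
    unfolding assms simple_graph_def by auto
  have "e \<notin> edge_cl (edges G - {e})" if eG: "e \<in> edges G" for e
  proof
    assume e: "e \<in> edge_cl (edges G - {e})"
    obtain n where n: "e = {n, Suc n}"
      using eG unfolding assms by (auto simp: numeral_3_eq_3 numeral_2_eq_2)
    have "(n, Suc n) \<in> conn (edges G - {e})"
      by (rule edge_clD) (use e n in simp)
    then have "Suc n \<le> n"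
      \<comment> \<open>Only the deleted edge leads from the vertices up to \<open>n\<close> to
        those beyond.\<close>
      by (rule conn_invariant[where P = "\<lambda>v. v \<le> n"]) (use n in \<open>auto simp: assms doubleton_eq_iff\<close>)
    then show False by simp
  qed
  then have "forest G"
    by (intro forest_if_indep) (simp add: edges.indep_def)
  then have "covers 1 (\<lambda>_. G) G \<and> (\<forall>i<1::nat. forest G)"
    using G unfolding covers_def subgraph_def by (simp add: lessThan_Suc)
  then have a: "arboricity G \<le> 1"
    unfolding arboricity_def by (intro Least_le) blast
  have "\<not> local_star_arboricity G \<le> 1"
  proof
    assume "local_star_arboricity G \<le> 1"
    then obtain D where D: "orientation G D" and load: "\<forall>v\<in>verts G. star_load D v \<le> 1"
      using local_star_arboricity_le_iff[OF G] by blast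
    note finD = orientation_finite[OF G D]
    have no_path: False if uv: "(u, v) \<in> D" and vw: "(v, w) \<in> D" for u v w
    proof -
      have "card {w. (v, w) \<in> D} \<noteq> 0"
        using vw finite_out[OF finD, of v] by auto
      then have "2 \<le> star_load D v"
        using uv unfolding star_load_def out_degree_def by auto
      then show False
        using load orientation_verts(2)[OF G D uv] by fastforce
    qed
    have unique: "w = w'" if w: "(v, w) \<in> D" and w': "(v, w') \<in> D" for v w w'
    proof -
      have "card {w. (v, w) \<in> D} \<le> 1"
        using load orientation_verts(1)[OF G D w] unfolding star_load_def out_degree_def by fastforce
      then show ?thesis
        using w w' finite_out[OF finD, of v] by (metis One_nat_def card_le_Suc0_iff_eq mem_Collect_eq)
    qed
    \<comment> \<open>The middle edge leaves 1 or 2. The outer edge at that vertex then either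
      enters it, giving a directed path, or is a second arc out of it.\<close>
    have "{0, 1} \<in> edges G" "{1, 2} \<in> edges G" "{2, 3} \<in> edges G"
      unfolding assms by simp_all
    then have "(0, 1) \<in> D \<or> (1, 0) \<in> D" "(1, 2) \<in> D \<or> (2, 1) \<in> D" "(2, 3) \<in> D \<or> (3, 2) \<in> D"
      using orientation_total[OF D] by metis+
    then show False
      using no_path unique[of 1 0 2] unique[of 2 1 3] by auto
  qed
  then show "arboricity G < local_star_arboricity G"
    using a by linarith
qed

lemma empty_graph_strict:
  fixes G :: "nat graph"
  assumes "G = \<lparr>verts = {}, edges = {}\<rparr>"
  shows "simple_graph G" "local_star_arboricity G < pseudoarboricity G + 1"
proof -
  show G: "simple_graph G"
    unfolding assms simple_graph_def by simp
  have "orientation G {}" "\<forall>v\<in>verts G. star_load {} v \<le> 0"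
    unfolding orientation_def assms by simp_all
  then have "local_star_arboricity G \<le> 0"
    using local_star_arboricity_le_iff[OF G] by blast
  then show "local_star_arboricity G < pseudoarboricity G + 1"
    by simp
qed

theorem theorem9:
  shows
    "(\<forall>G :: 'a graph. simple_graph G \<longrightarrow>
        pseudoarboricity G \<le> arboricity G \<and>
        arboricity G \<le> local_star_arboricity G \<and>
        local_star_arboricity G \<le> pseudoarboricity G + 1) \<and>
     (\<exists>G :: nat graph. simple_graph G \<and> pseudoarboricity G < arboricity G) \<and>
     (\<exists>G :: nat graph. simple_graph G \<and> arboricity G < local_star_arboricity G) \<and>
     (\<exists>G :: nat graph. simple_graph G \<and> local_star_arboricity G < pseudoarboricity G + 1) \<and>
     (\<forall>G :: 'a graph. simple_graph G \<longrightarrow>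
        (local_star_arboricity G = pseudoarboricity G \<longleftrightarrow>
          (\<exists>D. orientation G D \<and> max_out_degree G D = pseudoarboricity G \<and>
               (\<forall>v\<in>verts G. out_degree D v = pseudoarboricity G \<longrightarrow>
                             degree G v = pseudoarboricity G))))"
proof (intro conjI allI impI)
  fix G :: "'a graph"
  assume G: "simple_graph G"
  show "pseudoarboricity G \<le> arboricity G"
    using G by (rule pseudoarboricity_le_arboricity)
  show "arboricity G \<le> local_star_arboricity G"
    using G by (rule arboricity_le_local_star_arboricity)
  show "local_star_arboricity G \<le> pseudoarboricity G + 1"
    using G by (rule local_star_arboricity_le_Suc_pseudoarboricity)
next
  show "\<exists>G :: nat graph. simple_graph G \<and> pseudoarboricity G < arboricity G"
    using triangle_strict by blast
  show "\<exists>G :: nat graph. simple_graph G \<and> arboricity G < local_star_arboricity G"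
    using path_strict by blast
  show "\<exists>G :: nat graph. simple_graph G \<and> local_star_arboricity G < pseudoarboricity G + 1"
    using empty_graph_strict by blast
next
  fix G :: "'a graph"
  assume "simple_graph G"
  then show "local_star_arboricity G = pseudoarboricity G \<longleftrightarrow>
      (\<exists>D. orientation G D \<and> max_out_degree G D = pseudoarboricity G \<and>
           (\<forall>v\<in>verts G. out_degree D v = pseudoarboricity G \<longrightarrow>
                         degree G v = pseudoarboricity G))"
    by (rule local_star_arboricity_eq_pseudoarboricity_iff)
qed

end
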